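(* Let $a,b,c$ be positive numbers with $a<b<c$. The following are equivalent: (i) $\mathcal G(\chi_{[0,c)},a\mathbb Z\times\mathbb Z/b)$ is a Gabor frame; (ii) for every $t\in\mathbb R$, the only vector $\mathbf z$ with entries in $\{-1,0,1\}$ (indexed by $b\mathbb Z$) satisfying $\mathbf M_{a,b,c}(t)\mathbf z=0$ is $\mathbf z=0$; (iii) $\mathcal D_{a,b,c}=\emptyset$.
   Context: Gabor system: $\mathcal G(\phi,a\mathbb Z\times\mathbb Z/b)=\{e^{-2\pi i n t/b}\phi(t-ma):(m,n)\in\mathbb Z^2\}$; a Gabor frame is such a system that is a frame for $L^2(\mathbb R)$ (there are $0<A\le B<\infty$ with $A\|f\|_2^2\le\sum_{\psi}|\langle f,\psi\rangle|^2\le B\|f\|_2^2$ for all $f$). For $a,b,c>0$ and $t\in\mathbb R$, $\mathbf M_{a,b,c}(t)=(\chi_{[0,c)}(t-\mu+\lambda))_{\mu\in a\mathbb Z,\lambda\in b\mathbb Z}$ is the infinite matrix with rows indexed by $a\mathbb Z$ and columns by $b\mathbb Z$, acting by $(\mathbf M_{a,b,c}(t)\mathbf x)(\mu)=\sum_{\lambda\in b\mathbb Z}\chi_{[0,c)}(t-\mu+\lambda)\mathbf x(\lambda)$. $\mathcal B_b$ is the set of vectors $(\mathbf x(\lambda))_{\lambda\in b\mathbb Z}$ with entries in $\{0,1\}$, and $\mathcal B_b^0=\{\mathbf x\in\mathcal B_b:\mathbf x(0)=1\}$. $\mathbf 1$, $\mathbf 2$ denote the vectors indexed by $a\mathbb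 Z$ all of whose entries are $1$, resp. $2$. $\mathcal D_{a,b,c}=\{t\in\mathbb R:\mathbf M_{a,b,c}(t)\mathbf x=\mathbf 2\text{ for some }\mathbf x\in\mathcal B_b^0\}$. *)

theory Defs
  imports "HOL-Analysis.Analysis"
begin

definition L2 :: "(real \<Rightarrow> complex) set" where
  "L2 = {f. f \<in> borel_measurable lborel \<and> integrable lborel (\<lambda>t. (cmod (f t))\<^sup>2)}"

definition L2_inner :: "(real \<Rightarrow> complex) \<Rightarrow> (real \<Rightarrow> complex) \<Rightarrow> complex" where
  "L2_inner f g = (LINT t|lborel. f t * cnj (g t))"

definition L2_normsq :: "(real \<Rightarrow> complex) \<Rightarrow> real" where
  "L2_normsq f = (LINT t|lborel. (cmod (f t))\<^sup>2)"

definition gabor_atom :: "(real \<Rightarrow> complex) \<Rightarrow> real \<Rightarrow> real \<Rightarrow> int \<times> int \<Rightarrow> real \<Rightarrow> complex" where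
  "gabor_atom \<phi> a b mn t =
     exp (- 2 * pi * \<i> * of_int (snd mn) * of_real t / of_real b) * \<phi> (t - of_int (fst mn) * a)"

definition is_gabor_frame :: "(real \<Rightarrow> complex) \<Rightarrow> real \<Rightarrow> real \<Rightarrow> bool" where
  "is_gabor_frame \<phi> a b \<longleftrightarrow>
     (\<exists>A B::real. 0 < A \<and> A \<le> B \<and>
        (\<forall>f\<in>L2.
           ennreal (A * L2_normsq f)
             \<le> (\<integral>\<^sup>+ mn. ennreal ((cmod (L2_inner f (gabor_atom \<phi> a b mn)))\<^sup>2) \<partial>count_space UNIV) \<and>
           (\<integral>\<^sup>+ mn. ennreal ((cmod (L2_inner f (gabor_atom \<phi> a b mn)))\<^sup>2) \<partial>count_space UNIV)
             \<le> ennreal (B * L2_normsq f)))"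

text \<open>The matrix M_{a,b,c}(t) acting on a vector x indexed by bZ (x k is the entry at lambda = k b);
  the result is indexed by aZ (entry j is at mu = j a).\<close>
definition M_apply :: "real \<Rightarrow> real \<Rightarrow> real \<Rightarrow> real \<Rightarrow> (int \<Rightarrow> real) \<Rightarrow> int \<Rightarrow> real" where
  "M_apply a b c t x j =
     (\<Sum>\<^sub>\<infinity>k\<in>(UNIV::int set). indicator {0..<c} (t - of_int j * a + of_int k * b) * x k)"

definition B0 :: "(int \<Rightarrow> real) set" where
  "B0 = {x. (\<forall>k. x k \<in> {0, 1}) \<and> x 0 = 1}"

definition D_set :: "real \<Rightarrow> real \<Rightarrow> real \<Rightarrow> real set" where
  "D_set a b c = {t. \<exists>x\<in>B0. \<forall>j. M_apply a b c t x j = 2}"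

end

theory Submission
  imports Defs
begin

text \<open>
  Each row of \<open>M(t)\<close> is the indicator of an interval of consecutive integers, so a row sum is a
  difference of two values of the partial sums \<open>S\<close> of the vector. Replacing \<open>S\<close> by the truth value of
  \<open>S > \<theta>\<close> therefore turns any vector into one with entries in \<open>{-1, 0, 1}\<close> and keeps, for most
  \<open>\<theta>\<close>, the rows with small sum at zero. Combined with a compactness argument in \<open>t\<close> and in the
  vector, triviality of the \<open>{-1, 0, 1}\<close>-kernels bounds every entry of an arbitrary vector by
  boundedly many nearby row sums, which is a lower \<open>l^2\<close> bound uniform in \<open>t\<close>. Parseval's identity on
  a period, applied to each translate of the window, identifies the sum of the squared frame
  coefficients of \<open>f\<close> with \<open>b\<close> times the integral over \<open>[0, b)\<close> of the squared norm of \<open>M(t)\<close> applied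
  to the samples \<open>f(t + k b)\<close>; so the uniform bound gives a frame, and conversely a nonzero kernel
  vector, truncated to a long window, violates the lower frame bound. Applying \<open>mod 2\<close> or \<open>div m\<close>
  to the partial sums translates between kernel vectors and solutions of \<open>M(t) x = 2\<close>.
\<close>

section \<open>Row sums as differences of partial sums\<close>

text \<open>Condition (ii) is qualitative and concerns bounded vectors at single values of
  \<open>t\<close>; a frame bound is quantitative, concerns \<open>l^2\<close>, and sees
  \<open>t\<close> only up to null sets. Each mismatch shapes a part of the proof. Uniformity in
  \<open>t\<close> comes from a limit of counterexamples, but \<open>[0, c)\<close> is half-open, so
  the limit of the rows depends on the side of approach, and a limit from the left produces the
  window \<open>(0, c]\<close>. The radius obtained this way depends neither on \<open>t\<close> nor
  on the vector, which lets the squared entrywise bounds be summed with bounded overlap. Conversely,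
  a bad \<open>t\<close> is a single point, but rows are continuous from the right in
  \<open>t\<close>; a vector of finite support thus has constant row sums on some
  \<open>[t, t + \<eta>)\<close>, a set of positive measure that carries a test function.\<close>

definition psum :: "(int \<Rightarrow> 'a::ab_group_add) \<Rightarrow> int \<Rightarrow> 'a" where
  "psum x k = (if 0 \<le> k then sum x {0..<k} else - sum x {k..<0})"

lemma psum_0 [simp]: "psum x 0 = 0"
  by (simp add: psum_def)

lemma psum_add_1: "psum x (k + 1) = psum x k + x k"
proof (cases "0 \<le> k")
  case True
  then have "{0..<k + 1} = insert k {0..<k}" by auto
  with True show ?thesis by (simp add: psum_def add.commute)
next
  case False
  then have "{k..<0} = insert k {k + 1..<0}" by auto
  with False show ?thesis
    by (cases "k + 1 = 0") (auto simp: psum_def)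
qed

text \<open>Stated for every \<open>S\<close> with increments \<open>x\<close>, not just for
  \<open>psum x\<close>: below, \<open>S\<close> is also a partial sum composed with a threshold,
  with \<open>mod 2\<close> or with \<open>div m\<close>.\<close>

lemma sum_eq_diff:
  fixes S :: "int \<Rightarrow> 'a::ab_group_add"
  assumes "s \<le> e" and S: "\<And>k. S (k + 1) = S k + x k"
  shows "sum x {s..<e} = S e - S s"
  using \<open>s \<le> e\<close>
proof (induction e rule: int_ge_induct)
  case base
  show ?case by simp
next
  case (step e)
  then have "{s..<e + 1} = insert e {s..<e}" by auto
  with step show ?case by (simp add: S)
qed

lemma sum_eq_psum_diff: "s \<le> e \<Longrightarrow> sum x {s..<e} = psum x e - psum x s"
  by (rule sum_eq_diff) (simp_all add: psum_add_1)

text \<open>Thresholding the partial sums of \<open>x\<close> at level \<open>\<theta>\<close> turns \<open>x\<close> into a vector with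
  entries in \<open>{-1, 0, 1}\<close>, and destroys the vanishing of an interval sum only for \<open>\<theta>\<close> in a set
  whose length is the modulus of that interval sum.\<close>

lemma threshold_bound:
  fixes x :: "int \<Rightarrow> real" and s e :: "'j \<Rightarrow> int"
  assumes "finite J" and se: "\<And>j. s j \<le> e j"
    and sep: "\<And>z :: int \<Rightarrow> real. (\<And>k. z k \<in> {-1, 0, 1}) \<Longrightarrow> z 0 = 1 \<Longrightarrow>
                \<exists>j\<in>J. sum z {s j..<e j} \<noteq> 0"
  shows "x 0 \<le> (\<Sum>j\<in>J. \<bar>sum x {s j..<e j}\<bar>)"
proof (cases "x 0 > 0")
  case True
  define S where "S = psum x"
  let ?I = "\<lambda>j. {min (S (s j)) (S (e j))..max (S (s j)) (S (e j))}"
  have S1: "S 1 = x 0" using psum_add_1[of x 0] by (simp add: S_def)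
  \<comment> \<open>Since \<open>S 0 = 0\<close> and \<open>S 1 = x 0\<close>, the level is crossed
    upwards between the indices 0 and 1; hence the thresholded vector has entry 1 at 0 and
    \<open>sep\<close> applies to it.\<close>
  have sub: "{0..<x 0} \<subseteq> (\<Union>j\<in>J. ?I j)"
  proof
    fix \<theta> assume \<theta>: "\<theta> \<in> {0..<x 0}"
    define S' where "S' k = (of_bool (S k > \<theta>) :: real)" for k
    define z where "z k = S' (k + 1) - S' k" for k
    have "z k \<in> {-1, 0, 1}" for k by (auto simp: z_def S'_def)
    moreover have "z 0 = 1" using \<theta> by (simp add: z_def S'_def S1) (simp add: S_def)
    ultimately obtain j where j: "j \<in> J" "sum z {s j..<e j} \<noteq> 0" using sep by blast
    have "sum z {s j..<e j} = S' (e j) - S' (s j)"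
      by (rule sum_eq_diff) (simp_all add: se z_def)
    \<comment> \<open>A nonzero sum of \<open>z\<close> means that exactly one of the two end values
      exceeds \<open>\<theta>\<close>, so \<open>\<theta>\<close> lies between them.\<close>
    with j have "\<theta> \<in> ?I j" by (auto simp: S'_def of_bool_def split: if_splits)
    with j show "\<theta> \<in> (\<Union>j\<in>J. ?I j)" by blast
  qed
  have "ennreal (x 0) = emeasure lborel {0..<x 0}" using True by simp
  also have "\<dots> \<le> emeasure lborel (\<Union>j\<in>J. ?I j)" by (intro emeasure_mono sub) (use assms in auto)
  also have "\<dots> \<le> (\<Sum>j\<in>J. emeasure lborel (?I j))"
    by (rule emeasure_subadditive_finite) (use assms in auto)
  also have "\<dots> = (\<Sum>j\<in>J. ennreal \<bar>sum x {s j..<e j}\<bar>)"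
    by (intro sum.cong refl) (auto simp: sum_eq_psum_diff[OF se] S_def min_def max_def abs_real_def)
  also have "\<dots> = ennreal (\<Sum>j\<in>J. \<bar>sum x {s j..<e j}\<bar>)" by simp
  finally show ?thesis by (simp add: sum_nonneg)
next
  case False
  then show ?thesis by (smt (verit) sum_nonneg)
qed

section \<open>Rows of the matrix as intervals of indices\<close>

definition row_start :: "real \<Rightarrow> real \<Rightarrow> real \<Rightarrow> int \<Rightarrow> int" where
  "row_start a b t j = \<lceil>(of_int j * a - t) / b\<rceil>"

locale abc =
  fixes a b c :: real
  assumes a_pos: "0 < a" and a_less_b: "a < b" and b_less_c: "b < c"
begin

lemma b_pos: "0 < b" and c_pos: "0 < c"
  using a_pos a_less_b b_less_c by auto

text \<open>\<open>row_start a b t j\<close> is the least \<open>k\<close> with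
  \<open>t - j a + k b \<ge> 0\<close>; replacing \<open>t\<close> by \<open>t - c\<close> gives the
  least \<open>k\<close> at which this quantity reaches \<open>c\<close>, so one function describes
  both ends.\<close>

definition row :: "real \<Rightarrow> int \<Rightarrow> int set" where
  "row t j = {row_start a b t j..<row_start a b (t - c) j}"

lemma mem_row_iff: "k \<in> row t j \<longleftrightarrow> t - of_int j * a + of_int k * b \<in> {0..<c}"
  using b_pos by (auto simp: row_def row_start_def ceiling_le_iff less_ceiling_iff field_simps)

lemma finite_row [simp]: "finite (row t j)"
  by (simp add: row_def)

lemma row_start_le: "row_start a b t j \<le> row_start a b (t - c) j"
  unfolding row_start_def using b_pos c_pos by (intro ceiling_mono divide_right_mono) auto

text \<open>The quotient under the ceiling grows by \<open>a / b\<close>, which lies between 0 and 1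
  because \<open>a < b\<close>.\<close>

lemma row_start_Suc: "row_start a b t (j + 1) \<in> {row_start a b t j, row_start a b t j + 1}"
proof -
  have "(of_int (j + 1) * a - t) / b \<le> (of_int j * a - t) / b + 1"
       "(of_int j * a - t) / b \<le> (of_int (j + 1) * a - t) / b"
    using b_pos a_pos a_less_b by (auto simp: field_simps)
  then show ?thesis unfolding row_start_def
    by (smt (verit, best) ceiling_add_one ceiling_mono insertCI)
qed

lemma M_apply_eq_sum: "M_apply a b c t x j = sum x (row t j)"
proof -
  have "M_apply a b c t x j = (\<Sum>\<^sub>\<infinity>k\<in>row t j. x k)"
    unfolding M_apply_def
    by (rule infsum_cong_neutral) (auto simp: mem_row_iff split: split_indicator)
  then show ?thesis by simp
qed

lemma row_add_a: "row (t + of_int i * a) j = row t (j - i)"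
  by (auto simp: mem_row_iff algebra_simps)

lemma sum_row_add_b: "sum x (row (t + of_int i * b) j) = sum (\<lambda>k. x (k - i)) (row t j)"
  by (rule sum.reindex_bij_witness[where i="\<lambda>k. k - i" and j="\<lambda>k. k + i"])
     (auto simp: mem_row_iff algebra_simps)

text \<open>As \<open>a < c\<close>, the translates of \<open>[0, c)\<close> by multiples of
  \<open>a\<close> cover the line: \<open>t + k b\<close> lies in the one that starts at the largest
  multiple of \<open>a\<close> not exceeding it.\<close>

lemma ex_row: "\<exists>j. k \<in> row t j"
proof -
  obtain j :: int where "of_int j \<le> (t + of_int k * b) / a" "(t + of_int k * b) / a < of_int j + 1"
    by (metis floor_correct of_int_1 of_int_add)
  then have "of_int j * a \<le> t + of_int k * b" "t + of_int k * b < of_int j * a + a"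
    using a_pos by (simp_all add: pos_le_divide_eq pos_divide_less_eq algebra_simps)
  then have "k \<in> row t j" using a_less_b b_less_c by (auto simp: mem_row_iff)
  then show ?thesis ..
qed

section \<open>Equivalence of (ii) and (iii)\<close>

definition trivial_kernel :: bool where
  "trivial_kernel \<longleftrightarrow> (\<forall>t. \<forall>z::int \<Rightarrow> real.
     (\<forall>k. z k \<in> {-1, 0, 1}) \<and> (\<forall>j. sum z (row t j) = 0) \<longrightarrow> (\<forall>k. z k = 0))"

text \<open>Give the ones of \<open>x\<close> alternating signs: each row is an interval containing
  exactly two of them, which are neighbours among the ones and therefore cancel. The increments of
  the parity of the partial sums produce these signs.\<close>

lemma D_set_empty_if_trivial_kernel:
  assumes trivial_kernel
  shows "D_set a b c = {}"
proof (rule ccontr)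
  assume "D_set a b c \<noteq> {}"
  then obtain t and x :: "int \<Rightarrow> real" where x: "\<And>k. x k \<in> {0, 1}" "x 0 = 1" and row: "\<And>j. sum x (row t j) = 2"
    unfolding D_set_def B0_def M_apply_eq_sum by blast
  define T where "T = psum (\<lambda>k. if x k = 1 then 1 else 0 :: int)"
  define z where "z k = real_of_int (T (k + 1) mod 2 - T k mod 2)" for k
  have T1: "T (k + 1) = T k + (if x k = 1 then 1 else 0)" for k
    by (simp add: T_def psum_add_1)
  have "T (row_start a b (t - c) j) - T (row_start a b t j) = 2" for j
  proof -
    have "real_of_int (T (row_start a b (t - c) j) - T (row_start a b t j))
        = real_of_int (\<Sum>k\<in>row t j. if x k = 1 then 1 else 0)"
      unfolding row_def T_def by (simp add: sum_eq_psum_diff[OF row_start_le])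
    also have "\<dots> = sum x (row t j)" unfolding of_int_sum
      by (intro sum.cong refl) (use x in auto)
    finally show ?thesis using row[of j] by linarith
  qed
  then have T2: "T (row_start a b (t - c) j) mod 2 = T (row_start a b t j) mod 2" for j
    by (smt (verit) mod_add_self2)
  have "sum z (row t j) = 0" for j
    unfolding row_def using T2[of j]
    by (subst sum_eq_diff[where S="\<lambda>k. real_of_int (T k mod 2)"]) (auto simp: z_def row_start_le)
  moreover have "z k \<in> {-1, 0, 1}" for k
    unfolding z_def T1 by (cases "even (T k)") (auto simp: even_iff_mod_2_eq_zero odd_iff_mod_2_eq_one mod_add_eq)
  ultimately have "z 0 = 0" using assms unfolding trivial_kernel_def by blast
  moreover have "T 1 = 1" using T1[of 0] x by (simp add: T_def)
  ultimately show False by (simp add: z_def) (simp add: T_def)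
qed

text \<open>Consecutive rows gain and lose at most one index each, and a kernel vector must take the
  same value at the gained and the lost index; hence all rows contain the same number of
  nonzero entries, which is even. Keeping every \<open>m\<close>-th of them, for \<open>m\<close> half that number,
  leaves exactly two in each row.\<close>

lemma trivial_kernel_if_D_set_empty:
  assumes D: "D_set a b c = {}"
  shows trivial_kernel
proof (rule ccontr)
  assume "\<not> trivial_kernel"
  then obtain t and z :: "int \<Rightarrow> real" and k0
    where z: "\<And>k. z k \<in> {-1, 0, 1}" and ker: "\<And>j. sum z (row t j) = 0" and k0: "z k0 \<noteq> 0"
    unfolding trivial_kernel_def by blast
  define w where "w k = \<lfloor>z k\<rfloor>" for k
  have zw: "z k = of_int (w k)" for k using z[of k] by (auto simp: w_def)
  have w: "w k \<in> {-1, 0, 1}" for k using z[of k] unfolding zw by auto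
  define P where "P = psum w"
  define T where "T = psum (\<lambda>k. \<bar>w k\<bar>)"
  let ?s = "row_start a b t" and ?e = "row_start a b (t - c)"
  have P0: "P (?e j) = P (?s j)" for j
  proof -
    have "real_of_int (sum w (row t j)) = sum z (row t j)" by (simp add: zw)
    then have "sum w (row t j) = 0" using ker[of j] by linarith
    then show ?thesis unfolding row_def P_def by (simp add: sum_eq_psum_diff[OF row_start_le])
  qed
  have PS: "P (k + 1) = P k + w k" and TS: "T (k + 1) = T k + \<bar>w k\<bar>" for k
    by (simp_all add: P_def T_def psum_add_1)
  \<comment> \<open>If only one end moves, the index passed there must carry the entry 0, so the
    count of nonzero entries is unchanged in this case too.\<close>
  have step: "T (?e (j + 1)) - T (?s (j + 1)) = T (?e j) - T (?s j)" for j
    using row_start_Suc[of t j] row_start_Suc[of "t - c" j] P0[of j] P0[of "j + 1"]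
    by (auto simp: PS TS)
  have const: "T (?e j) - T (?s j) = T (?e 0) - T (?s 0)" for j
    by (induction j rule: int_induct[where k=0]) (use step[of "_ - 1"] step in auto)
  have T_sum: "(\<Sum>k\<in>row t j. \<bar>w k\<bar>) = T (?e 0) - T (?s 0)" for j
    using const[of j] by (simp add: row_def T_def sum_eq_psum_diff[OF row_start_le])
  \<comment> \<open>\<open>\<bar>w k\<bar>\<close> and \<open>w k\<close> have the same parity, so
    the number of nonzero entries in a row is even because its entries sum to 0.\<close>
  have "even (\<Sum>k\<in>row t 0. \<bar>w k\<bar>) \<longleftrightarrow> even (\<Sum>k\<in>row t 0. w k)"
    by (simp add: even_sum_iff)
  moreover have "(\<Sum>k\<in>row t 0. w k) = 0" using P0
    unfolding row_def P_def by (simp add: sum_eq_psum_diff[OF row_start_le])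
  ultimately have "even (T (?e 0) - T (?s 0))" by (simp add: T_sum)
  then obtain m where m: "T (?e 0) - T (?s 0) = 2 * m" by blast
  obtain j0 where "k0 \<in> row t j0" using ex_row by blast
  then have "\<bar>w k0\<bar> \<le> (\<Sum>k\<in>row t j0. \<bar>w k\<bar>)" by (intro member_le_sum) auto
  moreover have "w k0 \<noteq> 0" using k0 zw by auto
  ultimately have "m > 0" using T_sum[of j0] m by linarith
  \<comment> \<open>Over a row \<open>T\<close> grows by exactly \<open>2 * m\<close>, hence
    \<open>T div m\<close> by exactly 2, whatever the residue at the start; a single step of
    \<open>T\<close> is at most 1 and so raises the quotient by at most 1.\<close>
  define y where "y k = real_of_int (T (k + 1) div m - T k div m)" for k
  have y01: "y k \<in> {0, 1}" for k
  proof -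
    have "T k div m \<le> T (k + 1) div m" using \<open>m > 0\<close> by (intro zdiv_mono1) (auto simp: TS)
    moreover have "T (k + 1) div m \<le> (T k + m) div m"
      using \<open>m > 0\<close> w[of k] by (intro zdiv_mono1) (auto simp: TS)
    moreover have "(T k + m) div m = T k div m + 1" using \<open>m > 0\<close> by simp
    ultimately show ?thesis by (auto simp: y_def)
  qed
  have y2: "sum y (row t j) = 2" for j
  proof -
    have "T (?e j) = T (?s j) + 2 * m" using const[of j] m by simp
    then show ?thesis unfolding row_def using \<open>m > 0\<close>
      by (subst sum_eq_diff[where S="\<lambda>k. real_of_int (T k div m)"]) (auto simp: y_def row_start_le)
  qed
  \<comment> \<open>Membership in \<open>B0\<close> demands the entry 1 at index 0; shifting the
    indices by \<open>k1\<close> achieves it and moves \<open>t\<close> by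
    \<open>k1 * b\<close>.\<close>
  have "\<exists>k1. y k1 \<noteq> 0" using y2[of 0] by (metis sum.neutral zero_neq_numeral)
  then obtain k1 where k1: "y k1 = 1" using y01 by blast
  have "sum (\<lambda>k. y (k + k1)) (row (t + of_int k1 * b) j) = 2" for j
    using sum_row_add_b[of "\<lambda>k. y (k + k1)" t k1 j] y2 by simp
  then have "t + of_int k1 * b \<in> D_set a b c"
    unfolding D_set_def B0_def using k1 y01
    by (auto simp: M_apply_eq_sum intro!: exI[of _ "\<lambda>k. y (k + k1)"])
  then show False using D by simp
qed

end

section \<open>Compactness\<close>

lemma bounded_int_interval_card:
  fixes u v :: real
  assumes "0 < d" "0 \<le> v"
  shows "finite {j::int. u \<le> of_int j * d \<and> of_int j * d \<le> u + v}"
    and "real (card {j::int. u \<le> of_int j * d \<and> of_int j * d \<le> u + v}) \<le> v / d + 1"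
proof -
  have eq: "{j::int. u \<le> of_int j * d \<and> of_int j * d \<le> u + v} = {\<lceil>u / d\<rceil>..\<lfloor>(u + v) / d\<rfloor>}"
    using assms by (auto simp: ceiling_le_iff le_floor_iff field_simps)
  show "finite {j::int. u \<le> of_int j * d \<and> of_int j * d \<le> u + v}" by (simp add: eq)
  have "(u + v) / d = u / d + v / d" by (simp add: add_divide_distrib)
  moreover have "0 \<le> v / d" using assms by simp
  ultimately have "real_of_int (\<lfloor>(u + v) / d\<rfloor> - \<lceil>u / d\<rceil> + 1) \<le> v / d + 1"
    by linarith
  then show "real (card {j::int. u \<le> of_int j * d \<and> of_int j * d \<le> u + v}) \<le> v / d + 1"
    using \<open>0 \<le> v / d\<close> by (simp add: eq)
qed

text \<open>Tychonoff's theorem makes the product of copies of \<open>F\<close> compact, and as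
  \<open>int\<close> is countable the product is metrizable, hence sequentially compact. Since
  \<open>F\<close> is finite, convergence of a coordinate within \<open>F\<close> means that it is
  eventually constant.\<close>

lemma convergent_subseq_int_fun:
  fixes z :: "nat \<Rightarrow> int \<Rightarrow> real"
  assumes F: "finite F" and z: "\<And>n k. z n k \<in> F"
  shows "\<exists>r w. strict_mono (r :: nat \<Rightarrow> nat) \<and> (\<forall>k. w k \<in> F) \<and>
           (\<forall>k. \<forall>\<^sub>F n in sequentially. z (r n) k = w k)"
proof -
  let ?K = "PiE (UNIV :: int set) (\<lambda>_. F)"
  have "compactin (product_topology (\<lambda>_. euclidean) UNIV) ?K"
    unfolding compactin_PiE using F by (auto intro: finite_imp_compact)
  then have sc: "seq_compact ?K"
    by (simp add: euclidean_product_topology compact_eq_seq_compact_metric)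
  have "\<forall>n. z n \<in> ?K" using z by auto
  then obtain w r where w: "w \<in> ?K" and r: "strict_mono (r :: nat \<Rightarrow> nat)"
    and lim: "(z \<circ> r) \<longlonglongrightarrow> w"
    using seq_compactE[OF sc, of z] by metis
  have wF: "w k \<in> F" for k using w by auto
  have "\<forall>\<^sub>F n in sequentially. z (r n) k = w k" for k
  proof -
    have "(\<lambda>n. z (r n) k) \<longlonglongrightarrow> w k"
      using continuous_on_tendsto_compose[OF continuous_on_product_coordinates lim, of k]
      by (simp add: o_def)
    moreover have "open (- (F - {w k}))" using F by (intro open_Compl finite_imp_closed) simp
    ultimately have "\<forall>\<^sub>F n in sequentially. z (r n) k \<in> - (F - {w k})"
      by (rule topological_tendstoD) auto
    then show ?thesis by eventually_elim (use z in auto)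
  qed
  with r wF show ?thesis by blast
qed

text \<open>A monotone subsequence stays on one side of its limit once an initial segment is
  dropped: if it takes values on both sides it is increasing, and after reaching \<open>t'\<close>
  it does not fall below again.\<close>

lemma one_sided_convergent_subseq:
  fixes t :: "nat \<Rightarrow> real"
  assumes "\<And>n. t n \<in> {l..u}"
  obtains r t' where "strict_mono (r :: nat \<Rightarrow> nat)" "(\<lambda>n. t (r n)) \<longlonglongrightarrow> t'"
    "(\<forall>n. t (r n) \<ge> t') \<or> (\<forall>n. t (r n) < t')"
proof -
  obtain r where r: "strict_mono (r :: nat \<Rightarrow> nat)" and mono: "monoseq (\<lambda>n. t (r n))"
    using seq_monosub by blast
  have "Bseq (\<lambda>n. t (r n))"
    using assms by (intro BseqI'[of _ "\<bar>l\<bar> + \<bar>u\<bar>"]) (smt (verit, best) atLeastAtMost_iff real_norm_def)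
  then obtain t' where t': "(\<lambda>n. t (r n)) \<longlonglongrightarrow> t'"
    using mono Bseq_monoseq_convergent by (auto simp: convergent_def)
  show thesis
  proof (cases "(\<forall>n. t (r n) \<ge> t') \<or> (\<forall>n. t (r n) < t')")
    case True
    then show ?thesis using r t' that by blast
  next
    case False
    then obtain m n where mn: "t (r n) < t'" "t (r m) \<ge> t'" by (auto simp: not_le not_less)
    have inc: "incseq (\<lambda>n. t (r n))"
    proof (rule ccontr)
      assume "\<not> ?thesis"
      then have "decseq (\<lambda>n. t (r n))" using mono by (auto simp: monoseq_iff)
      then have "t' \<le> t (r n)" using t' by (rule decseq_ge)
      then show False using mn by simp
    qed
    have "t (r (m + k)) \<ge> t'" for k using incseqD[OF inc, of m "m + k"] mn by simp
    moreover have "(\<lambda>k. t (r (m + k))) \<longlonglongrightarrow> t'"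
      using LIMSEQ_ignore_initial_segment[OF t', of m] by (simp add: add.commute)
    moreover have "strict_mono (\<lambda>k. r (m + k))" using r by (simp add: strict_mono_def)
    ultimately show ?thesis using that by blast
  qed
qed

context abc
begin

text \<open>When \<open>t\<close> is approached from below, the window \<open>[0, c)\<close> becomes \<open>(0, c]\<close> in the limit;
  the reflection \<open>t \<mapsto> c - t\<close>, \<open>k \<mapsto> - k\<close> leads back to the original rows.\<close>

definition row' :: "real \<Rightarrow> int \<Rightarrow> int set" where
  "row' t j = {k. t - of_int j * a + of_int k * b \<in> {0<..c}}"

lemma trivial_kernel_row':
  assumes trivial_kernel and z: "\<And>k. z k \<in> {-1, 0, 1 :: real}" and "\<And>j. sum z (row' t j) = 0"
  shows "z k = 0"
proof -
  have "sum (\<lambda>k. z (- k)) (row (c - t) j) = sum z (row' t (- j))" for j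
    by (rule sum.reindex_bij_witness[where i=uminus and j=uminus])
       (auto simp: mem_row_iff row'_def algebra_simps)
  then have "\<forall>k. z (- k) = 0"
    using assms unfolding trivial_kernel_def by (metis (no_types, lifting))
  then show ?thesis by (metis minus_minus)
qed

text \<open>Eventual agreement index by index is enough, because all rows for parameters within 1 of
  \<open>t'\<close> lie in one finite set.\<close>

lemma eventually_row_eqI:
  assumes t: "(t \<longlongrightarrow> t') F"
    and mem: "\<And>k. \<forall>\<^sub>F n in F. k \<in> row (t n) j \<longleftrightarrow> k \<in> R"
    and R: "R \<subseteq> {k. t' - of_int j * a + of_int k * b \<in> {0..c}}"
  shows "\<forall>\<^sub>F n in F. row (t n) j = R"
proof -
  let ?K = "{k::int. of_int j * a - t' - 1 \<le> of_int k * b \<and> of_int k * b \<le> of_int j * a - t' - 1 + (c + 2)}"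
  have "finite ?K" using b_pos c_pos by (intro bounded_int_interval_card) auto
  then have "\<forall>\<^sub>F n in F. \<forall>k\<in>?K. k \<in> row (t n) j \<longleftrightarrow> k \<in> R"
    by (intro eventually_ball_finite ballI mem)
  moreover have "\<forall>\<^sub>F n in F. dist (t n) t' < 1"
    using t by (rule tendstoD) simp
  ultimately show ?thesis
  proof eventually_elim
    case (elim n)
    have "row (t n) j \<subseteq> ?K"
      using elim(2) by (auto simp: mem_row_iff dist_real_def)
    moreover have "R \<subseteq> ?K" using R by force
    ultimately show ?case using elim(1) by blast
  qed
qed

text \<open>With \<open>d = k b - j a\<close>, the conditions \<open>t' + d < 0\<close> and
  \<open>t' + d < c\<close> are open, while the reverse inequalities persist because
  \<open>t n \<ge> t'\<close>: the half-open window is continuous from the right.\<close>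

lemma eventually_row_eq:
  assumes t: "(t \<longlongrightarrow> t') F" and ge: "\<forall>\<^sub>F n in F. t' \<le> t n"
  shows "\<forall>\<^sub>F n in F. row (t n) j = row t' j"
proof (rule eventually_row_eqI[OF t])
  fix k
  define d where "d = of_int k * b - of_int j * a"
  have u: "((\<lambda>n. t n + d) \<longlongrightarrow> t' + d) F" by (intro tendsto_intros t)
  have "\<forall>\<^sub>F n in F. t' + d < 0 \<longrightarrow> t n + d < 0" "\<forall>\<^sub>F n in F. t' + d < c \<longrightarrow> t n + d < c"
    by (simp_all add: order_tendstoD[OF u])
  then show "\<forall>\<^sub>F n in F. (k \<in> row (t n) j) = (k \<in> row t' j)"
    using ge by eventually_elim (auto simp: mem_row_iff d_def)
qed (auto simp: mem_row_iff)

text \<open>Seen from the left, a point at the end 0 has not yet entered the window and a point at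
  \<open>c\<close> has not yet left it; everywhere else membership is stable.\<close>

lemma eventually_row_eq_row':
  assumes t: "(t \<longlongrightarrow> t') F" and less: "\<forall>\<^sub>F n in F. t n < t'"
  shows "\<forall>\<^sub>F n in F. row (t n) j = row' t' j"
proof (rule eventually_row_eqI[OF t])
  fix k
  define d where "d = of_int k * b - of_int j * a"
  have u: "((\<lambda>n. t n + d) \<longlongrightarrow> t' + d) F" by (intro tendsto_intros t)
  have "\<forall>\<^sub>F n in F. 0 < t' + d \<longrightarrow> 0 < t n + d" "\<forall>\<^sub>F n in F. c < t' + d \<longrightarrow> c < t n + d"
    by (simp_all add: order_tendstoD[OF u])
  then show "\<forall>\<^sub>F n in F. (k \<in> row (t n) j) = (k \<in> row' t' j)"
    using less by eventually_elim (auto simp: mem_row_iff row'_def d_def)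
qed (auto simp: row'_def)

text \<open>If no radius worked, there would be vectors with entry 1 at 0 whose row sums vanish on
  windows of growing radius. A limit of them has all row sums zero, and the entry 1 survives because
  each entry is eventually constant along the subsequence.\<close>

lemma uniform_separation:
  assumes trivial_kernel
  obtains D where "0 \<le> D" "\<And>t z. (\<And>k. z k \<in> {-1, 0, 1 :: real}) \<Longrightarrow> z 0 = 1 \<Longrightarrow>
    \<exists>j. \<bar>of_int j * a - t\<bar> \<le> D \<and> sum z (row t j) \<noteq> 0"
proof (rule ccontr)
  assume "\<not> thesis"
  then have "\<exists>t z. (\<forall>k. z k \<in> {-1, 0, 1 :: real}) \<and> z 0 = 1 \<and>
      (\<forall>j. \<bar>of_int j * a - t\<bar> \<le> real n \<longrightarrow> sum z (row t j) = 0)" for n :: nat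
    using that[of "real n"] by (metis of_nat_0_le_iff)
  then obtain t z where z: "\<And>n k. z n k \<in> {-1, 0, 1 :: real}" and z0: "\<And>n. z n 0 = 1"
    and ker: "\<And>n j. \<bar>of_int j * a - t n\<bar> \<le> real n \<Longrightarrow> sum (z n) (row (t n) j) = 0"
    by metis
  \<comment> \<open>Moving \<open>t\<close> by a multiple of \<open>a\<close> only renumbers the
    rows, so the parameters can be taken in the compact interval \<open>[0, a]\<close>. Multiples of
    \<open>b\<close> would instead shift the vector and lose the normalisation at 0.\<close>
  define i where "i n = \<lfloor>t n / a\<rfloor>" for n
  define u where "u n = t n - of_int (i n) * a" for n
  have u: "u n \<in> {0..a}" for n
  proof -
    have "of_int (i n) \<le> t n / a" "t n / a < of_int (i n) + 1" by (auto simp: i_def)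
    then have "of_int (i n) * a \<le> t n" "t n < of_int (i n) * a + a"
      using a_pos by (simp_all add: pos_le_divide_eq pos_divide_less_eq algebra_simps)
    then show ?thesis by (auto simp: u_def)
  qed
  have ker_u: "sum (z n) (row (u n) j) = 0" if "\<bar>of_int j * a - u n\<bar> \<le> real n" for n j
  proof -
    have "sum (z n) (row (t n) (j + i n)) = 0"
      using that by (intro ker) (auto simp: u_def algebra_simps)
    then show ?thesis using row_add_a[of "u n" "i n" "j + i n"] by (simp add: u_def)
  qed
  obtain r t' where r: "strict_mono r" and lim: "(\<lambda>n. u (r n)) \<longlonglongrightarrow> t'"
    and side: "(\<forall>n. u (r n) \<ge> t') \<or> (\<forall>n. u (r n) < t')"
    by (rule one_sided_convergent_subseq[OF u])
  have fin: "finite {-1, 0, 1 :: real}" by simp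
  have zr: "z (r n) k \<in> {-1, 0, 1}" for n k by (rule z)
  obtain q w where q: "strict_mono q" and w: "\<And>k. w k \<in> {-1, 0, 1 :: real}"
    and ev: "\<And>k. \<forall>\<^sub>F n in sequentially. z (r (q n)) k = w k"
    using convergent_subseq_int_fun[where z="\<lambda>n. z (r n)", OF fin zr] by blast
  have lim_q: "(\<lambda>n. u (r (q n))) \<longlonglongrightarrow> t'"
    using LIMSEQ_subseq_LIMSEQ[OF lim q] by (simp add: o_def)
  have rq: "strict_mono (\<lambda>n. r (q n))" using r q by (simp add: strict_mono_def)
  have w0: "w 0 = 1"
  proof -
    obtain n where "z (r (q n)) 0 = w 0" using ev[of 0] by (auto simp: eventually_sequentially)
    then show ?thesis using z0 by simp
  qed
  \<comment> \<open>\<open>R\<close> is left open so that the same argument covers the limit row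
    from either side.\<close>
  have limit_row: "sum w R = 0" if R: "\<forall>\<^sub>F n in sequentially. row (u (r (q n))) j = R" for j R
  proof -
    obtain n where "row (u (r (q n))) j = R" using R by (auto simp: eventually_sequentially)
    then have "finite R" by auto
    then have "\<forall>\<^sub>F n in sequentially. \<forall>k\<in>R. z (r (q n)) k = w k"
      by (intro eventually_ball_finite ballI ev)
    \<comment> \<open>Since \<open>u\<close> stays in \<open>[0, a]\<close>, this puts row
      \<open>j\<close> within the radius for which \<open>ker_u\<close> holds.\<close>
    moreover have "\<forall>\<^sub>F n in sequentially. \<bar>of_int j * a\<bar> + a \<le> real n"
      using filterlim_real_sequentially by (simp add: filterlim_at_top)
    ultimately have "\<forall>\<^sub>F n in sequentially. sum w R = 0"
      using R
    proof eventually_elim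
      case (elim n)
      have "real n \<le> real (r (q n))" using strict_mono_imp_increasing[OF rq, of n] by simp
      then have "sum (z (r (q n))) (row (u (r (q n))) j) = 0"
        using elim(2) u[of "r (q n)"] by (intro ker_u) auto
      moreover have "sum (z (r (q n))) R = sum w R" using elim(1) by (intro sum.cong) auto
      ultimately show ?case using elim(3) by simp
    qed
    then show ?thesis by simp
  qed
  from side show False
  proof
    assume "\<forall>n. u (r n) \<ge> t'"
    then have "sum w (row t' j) = 0" for j
      by (intro limit_row[of j] eventually_row_eq[OF lim_q]) auto
    then have "w 0 = 0" using assms w unfolding trivial_kernel_def by blast
    then show False using w0 by simp
  next
    assume "\<forall>n. u (r n) < t'"
    then have "sum w (row' t' j) = 0" for j
      by (intro limit_row[of j] eventually_row_eq_row'[OF lim_q]) auto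
    then have "w 0 = 0" using assms w trivial_kernel_row' by blast
    then show False using w0 by simp
  qed
qed

end

section \<open>Density in \<open>L\<^sup>2\<close> of a finite measure\<close>

lemma cmod_diff_sq_le: "(cmod (x - z))\<^sup>2 \<le> 2 * (cmod (x - y))\<^sup>2 + 2 * (cmod (y - z))\<^sup>2"
proof -
  have "cmod (x - z) \<le> cmod (x - y) + cmod (y - z)" by norm
  then have "(cmod (x - z))\<^sup>2 \<le> (cmod (x - y) + cmod (y - z))\<^sup>2" by (intro power_mono) auto
  also have "\<dots> \<le> 2 * (cmod (x - y))\<^sup>2 + 2 * (cmod (y - z))\<^sup>2"
    using sum_squares_bound[of "cmod (x - y)" "cmod (y - z)"] by (simp add: power2_sum)
  finally show ?thesis .
qed

lemma ennreal_quarters: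
  assumes "\<epsilon> > 0"
  shows "2 * ennreal (\<epsilon> / 4) + 2 * ennreal (\<epsilon> / 4) = ennreal \<epsilon>"
proof -
  have "ennreal (2 * (\<epsilon> / 4)) = 2 * ennreal (\<epsilon> / 4)"
    using ennreal_mult'[of 2 "\<epsilon> / 4"] by (simp del: times_divide_eq_right)
  moreover have "ennreal (2 * (\<epsilon> / 4) + 2 * (\<epsilon> / 4)) = ennreal (2 * (\<epsilon> / 4)) + ennreal (2 * (\<epsilon> / 4))"
    using assms by (intro ennreal_plus) auto
  moreover have "2 * (\<epsilon> / 4) + 2 * (\<epsilon> / 4) = \<epsilon>" by simp
  ultimately show ?thesis by (simp only:)
qed

text \<open>The squared \<open>L^2\<close> distance as an extended nonnegative number, so that no
  integrability has to be tracked. The price is the factor 2 in the triangle inequality, whence the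
  \<open>\<epsilon> / 4\<close> in later proofs.\<close>

definition dist2 :: "'a measure \<Rightarrow> ('a \<Rightarrow> complex) \<Rightarrow> ('a \<Rightarrow> complex) \<Rightarrow> ennreal" where
  "dist2 M f g = (\<integral>\<^sup>+x. ennreal ((cmod (f x - g x))\<^sup>2) \<partial>M)"

lemma dist2_triangle:
  assumes [measurable]: "f \<in> borel_measurable M" "g \<in> borel_measurable M" "h \<in> borel_measurable M"
  shows "dist2 M f h \<le> 2 * dist2 M f g + 2 * dist2 M g h"
proof -
  have "dist2 M f h \<le> (\<integral>\<^sup>+x. 2 * ennreal ((cmod (f x - g x))\<^sup>2) + 2 * ennreal ((cmod (g x - h x))\<^sup>2) \<partial>M)"
    unfolding dist2_def
  proof (rule nn_integral_mono)
    fix x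
    have "ennreal ((cmod (f x - h x))\<^sup>2) \<le> ennreal (2 * (cmod (f x - g x))\<^sup>2 + 2 * (cmod (g x - h x))\<^sup>2)"
      by (intro ennreal_leI cmod_diff_sq_le)
    then show "ennreal ((cmod (f x - h x))\<^sup>2)
        \<le> 2 * ennreal ((cmod (f x - g x))\<^sup>2) + 2 * ennreal ((cmod (g x - h x))\<^sup>2)"
      by (simp add: ennreal_mult)
  qed
  then show ?thesis by (simp add: dist2_def nn_integral_add nn_integral_cmult)
qed

definition L2_closure :: "'a measure \<Rightarrow> ('a \<Rightarrow> complex) set \<Rightarrow> ('a \<Rightarrow> complex) set" where
  "L2_closure M U = {g \<in> borel_measurable M. \<forall>\<epsilon>>0. \<exists>u\<in>U. dist2 M g u < ennreal \<epsilon>}"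

context
  fixes M :: "'a measure" and U :: "('a \<Rightarrow> complex) set"
  assumes U: "\<And>u. u \<in> U \<Longrightarrow> u \<in> borel_measurable M"
begin

lemma L2_closure_measurable: "g \<in> L2_closure M U \<Longrightarrow> g \<in> borel_measurable M"
  by (simp add: L2_closure_def)

lemma L2_closureE:
  assumes "g \<in> L2_closure M U" "\<epsilon> > 0"
  obtains u where "u \<in> U" "dist2 M g u < ennreal \<epsilon>"
  using assms unfolding L2_closure_def by blast

lemma L2_closure_base: "u \<in> U \<Longrightarrow> u \<in> L2_closure M U"
  using U by (auto simp: L2_closure_def dist2_def intro!: bexI[of _ u])

lemma L2_closure_closed:
  assumes g: "g \<in> borel_measurable M"
    and ex: "\<And>\<epsilon>. \<epsilon> > 0 \<Longrightarrow> \<exists>h\<in>L2_closure M U. dist2 M g h < ennreal \<epsilon>"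
  shows "g \<in> L2_closure M U"
  unfolding L2_closure_def
proof (intro CollectI conjI g allI impI)
  fix \<epsilon> :: real assume "\<epsilon> > 0"
  then obtain h where h: "h \<in> L2_closure M U" "dist2 M g h < ennreal (\<epsilon> / 4)"
    using ex[of "\<epsilon> / 4"] by auto
  then obtain u where u: "u \<in> U" "dist2 M h u < ennreal (\<epsilon> / 4)"
    using \<open>\<epsilon> > 0\<close> by (auto elim: L2_closureE[of h "\<epsilon> / 4"])
  have "dist2 M g u \<le> 2 * dist2 M g h + 2 * dist2 M h u"
    by (intro dist2_triangle g L2_closure_measurable[OF h(1)] U[OF u(1)])
  also have "\<dots> < 2 * ennreal (\<epsilon> / 4) + 2 * ennreal (\<epsilon> / 4)"
    using h u by (intro add_strict_mono ennreal_mult_strict_left_mono) auto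
  also have "\<dots> = ennreal \<epsilon>" using \<open>\<epsilon> > 0\<close> by (rule ennreal_quarters)
  finally show "\<exists>u\<in>U. dist2 M g u < ennreal \<epsilon>" using u by auto
qed

lemma L2_closure_cong:
  assumes "g \<in> L2_closure M U" "h \<in> borel_measurable M" "AE x in M. h x = g x"
  shows "h \<in> L2_closure M U"
proof (rule L2_closure_closed[OF assms(2)])
  fix \<epsilon> :: real assume "\<epsilon> > 0"
  have "dist2 M h g = (\<integral>\<^sup>+x. 0 \<partial>M)"
    unfolding dist2_def using assms(3) by (intro nn_integral_cong_AE) auto
  with \<open>\<epsilon> > 0\<close> assms(1) show "\<exists>g\<in>L2_closure M U. dist2 M h g < ennreal \<epsilon>"
    by (intro bexI[of _ g]) auto
qed

lemma L2_closure_limit: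
  assumes s: "\<And>n :: nat. s n \<in> L2_closure M U" and g [measurable]: "g \<in> borel_measurable M"
    and lim: "AE x in M. (\<lambda>n. s n x) \<longlonglongrightarrow> g x"
    and w [measurable]: "w \<in> borel_measurable M" and w_fin: "(\<integral>\<^sup>+x. ennreal ((w x)\<^sup>2) \<partial>M) < \<infinity>"
    and bound: "\<And>n. AE x in M. cmod (s n x) \<le> w x" and bound_g: "AE x in M. cmod (g x) \<le> w x"
  shows "g \<in> L2_closure M U"
proof (rule L2_closure_closed[OF g])
  fix \<epsilon> :: real assume "\<epsilon> > 0"
  have [measurable]: "s n \<in> borel_measurable M" for n using s by (rule L2_closure_measurable)
  have "(\<lambda>n. dist2 M g (s n)) \<longlonglongrightarrow> (\<integral>\<^sup>+x. 0 \<partial>M)"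
    unfolding dist2_def
  proof (rule nn_integral_dominated_convergence[where w="\<lambda>x. 4 * ennreal ((w x)\<^sup>2)"])
    show "AE x in M. ennreal ((cmod (g x - s n x))\<^sup>2) \<le> 4 * ennreal ((w x)\<^sup>2)" for n
      using bound[of n] bound_g
    proof eventually_elim
      case (elim x)
      have "cmod (g x - s n x) \<le> 2 * w x" using elim norm_triangle_ineq4[of "g x" "s n x"] by simp
      then have "(cmod (g x - s n x))\<^sup>2 \<le> (2 * w x)\<^sup>2" by (intro power_mono) auto
      then have "ennreal ((cmod (g x - s n x))\<^sup>2) \<le> ennreal (4 * (w x)\<^sup>2)"
        by (intro ennreal_leI) (simp add: power_mult_distrib)
      then show ?case by (simp add: ennreal_mult')
    qed
    show "(\<integral>\<^sup>+x. 4 * ennreal ((w x)\<^sup>2) \<partial>M) < \<infinity>"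
      using w_fin by (simp add: nn_integral_cmult ennreal_mult_less_top)
    show "AE x in M. (\<lambda>n. ennreal ((cmod (g x - s n x))\<^sup>2)) \<longlonglongrightarrow> 0"
      using lim
    proof eventually_elim
      case (elim x)
      have "(\<lambda>n. ennreal ((cmod (g x - s n x))\<^sup>2)) \<longlonglongrightarrow> ennreal ((cmod (g x - g x))\<^sup>2)"
        by (intro tendsto_intros elim)
      then show ?case by simp
    qed
  qed auto
  then have "(\<lambda>n. dist2 M g (s n)) \<longlonglongrightarrow> 0" by simp
  then have "\<forall>\<^sub>F n in sequentially. dist2 M g (s n) < ennreal \<epsilon>"
    using \<open>\<epsilon> > 0\<close> by (intro order_tendstoD) auto
  then obtain n where "dist2 M g (s n) < ennreal \<epsilon>" by (auto simp: eventually_sequentially)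
  with s show "\<exists>h\<in>L2_closure M U. dist2 M g h < ennreal \<epsilon>" by blast
qed

lemma L2_closure_add:
  assumes add: "\<And>u v. u \<in> U \<Longrightarrow> v \<in> U \<Longrightarrow> (\<lambda>x. u x + v x) \<in> U"
    and g: "g \<in> L2_closure M U" and h: "h \<in> L2_closure M U"
  shows "(\<lambda>x. g x + h x) \<in> L2_closure M U"
  unfolding L2_closure_def
proof (intro CollectI conjI allI impI)
  note [measurable] = L2_closure_measurable[OF g] L2_closure_measurable[OF h]
  show "(\<lambda>x. g x + h x) \<in> borel_measurable M" by simp
  fix \<epsilon> :: real assume "\<epsilon> > 0"
  then have "\<epsilon> / 4 > 0" by simp
  obtain u where u: "u \<in> U" "dist2 M g u < ennreal (\<epsilon> / 4)"
    using g \<open>\<epsilon> / 4 > 0\<close> by (rule L2_closureE)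
  obtain v where v: "v \<in> U" "dist2 M h v < ennreal (\<epsilon> / 4)"
    using h \<open>\<epsilon> / 4 > 0\<close> by (rule L2_closureE)
  note [measurable] = U[OF u(1)] U[OF v(1)]
  have "dist2 M (\<lambda>x. g x + h x) (\<lambda>x. u x + v x)
      \<le> 2 * dist2 M (\<lambda>x. g x + h x) (\<lambda>x. u x + h x) + 2 * dist2 M (\<lambda>x. u x + h x) (\<lambda>x. u x + v x)"
    by (rule dist2_triangle) auto
  also have "\<dots> = 2 * dist2 M g u + 2 * dist2 M h v" by (simp add: dist2_def)
  also have "\<dots> < 2 * ennreal (\<epsilon> / 4) + 2 * ennreal (\<epsilon> / 4)"
    using u v by (intro add_strict_mono ennreal_mult_strict_left_mono) auto
  also have "\<dots> = ennreal \<epsilon>" using \<open>\<epsilon> > 0\<close> by (rule ennreal_quarters)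
  finally show "\<exists>u\<in>U. dist2 M (\<lambda>x. g x + h x) u < ennreal \<epsilon>"
    using add[OF u(1) v(1)] by (intro bexI[of _ "\<lambda>x. u x + v x"]) auto
qed

lemma L2_closure_cmult:
  assumes cmult: "\<And>k u. u \<in> U \<Longrightarrow> (\<lambda>x. k * u x) \<in> U" and g: "g \<in> L2_closure M U"
  shows "(\<lambda>x. k * g x) \<in> L2_closure M U"
  unfolding L2_closure_def
proof (intro CollectI conjI allI impI)
  note [measurable] = L2_closure_measurable[OF g]
  show "(\<lambda>x. k * g x) \<in> borel_measurable M" by simp
  fix \<epsilon> :: real assume "\<epsilon> > 0"
  define C where "C = (cmod k)\<^sup>2 + 1"
  have "C > 0" by (simp add: C_def add_nonneg_pos)
  with \<open>\<epsilon> > 0\<close> have "\<epsilon> / C > 0" by simp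
  obtain u where u: "u \<in> U" "dist2 M g u < ennreal (\<epsilon> / C)"
    using g \<open>\<epsilon> / C > 0\<close> by (rule L2_closureE)
  note [measurable] = U[OF u(1)]
  have "dist2 M (\<lambda>x. k * g x) (\<lambda>x. k * u x) = ennreal ((cmod k)\<^sup>2) * dist2 M g u"
    unfolding dist2_def right_diff_distrib[symmetric] norm_mult power_mult_distrib
    by (simp add: ennreal_mult nn_integral_cmult)
  also have "\<dots> \<le> ennreal C * dist2 M g u" by (intro mult_right_mono) (auto simp: C_def)
  also have "\<dots> < ennreal C * ennreal (\<epsilon> / C)"
    using u \<open>C > 0\<close> by (intro ennreal_mult_strict_left_mono) auto
  also have "\<dots> = ennreal \<epsilon>" using \<open>C > 0\<close> \<open>\<epsilon> > 0\<close> by (subst ennreal_mult[symmetric]) auto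
  finally show "\<exists>u\<in>U. dist2 M (\<lambda>x. k * g x) u < ennreal \<epsilon>"
    using cmult[OF u(1)] by (intro bexI[of _ "\<lambda>x. k * u x"]) auto
qed

text \<open>The sets whose indicators lie in the closure form a Dynkin system: complements come from
  subtracting from the constant 1, disjoint unions from dominated convergence with bound 1, which is
  square integrable for a finite measure. An intersection-stable generator thus yields all
  measurable sets; simple functions dominated by \<open>2 * cmod (g x)\<close> give the
  rest.\<close>

lemma L2_closure_eq_L2:
  assumes "finite_measure M"
    and add: "\<And>u v. u \<in> U \<Longrightarrow> v \<in> U \<Longrightarrow> (\<lambda>x. u x + v x) \<in> U"
    and cmult: "\<And>k u. u \<in> U \<Longrightarrow> (\<lambda>x. k * u x) \<in> U"
    and one: "(\<lambda>_. 1) \<in> U"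
    and G: "Int_stable G" "G \<subseteq> Pow (space M)" "sets M = sigma_sets (space M) G"
    and ind: "\<And>A. A \<in> G \<Longrightarrow> indicator A \<in> L2_closure M U"
    and g [measurable]: "g \<in> borel_measurable M" and g2: "(\<integral>\<^sup>+x. ennreal ((cmod (g x))\<^sup>2) \<partial>M) < \<infinity>"
  shows "g \<in> L2_closure M U"
proof -
  interpret finite_measure M by fact
  have clo_add: "(\<lambda>x. g x + h x) \<in> L2_closure M U" if "g \<in> L2_closure M U" "h \<in> L2_closure M U" for g h
    using add that by (rule L2_closure_add)
  have clo_cmult: "(\<lambda>x. k * g x) \<in> L2_closure M U" if "g \<in> L2_closure M U" for k g
    using cmult that by (rule L2_closure_cmult)
  have zero: "(\<lambda>_. 0) \<in> L2_closure M U" using clo_cmult[OF L2_closure_base[OF one], of 0] by simp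
  have clo_sum: "(\<lambda>x. \<Sum>i\<in>I. s i x) \<in> L2_closure M U"
    if "finite I" "\<And>i. i \<in> I \<Longrightarrow> s i \<in> L2_closure M U" for I :: "'i set" and s
    using that by (induction I rule: finite_induct) (auto simp: zero clo_add)
  have "emeasure M (space M) < top"
    using emeasure_finite[of "space M"] unfolding infinity_ennreal_def less_top .
  then have fin1: "(\<integral>\<^sup>+x. ennreal (1\<^sup>2) \<partial>M) < \<infinity>" by simp
  have ind_sets: "indicator A \<in> L2_closure M U" if "A \<in> sets M" for A
  proof -
    from that have "A \<in> sigma_sets (space M) G" using G(3) by simp
    with G(1,2) show ?thesis
    proof (induction rule: sigma_sets_induct_disjoint)
      case (basic A)
      then show ?case by (rule ind)
    next
      case empty
      show ?case using zero by (simp add: indicator_def[abs_def])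
    next
      case (compl A)
      have [measurable]: "A \<in> sets M" using compl(1) unfolding G(3) .
      have "(\<lambda>x. 1 + (- 1) * indicator A x) \<in> L2_closure M U"
        by (intro clo_add clo_cmult compl(2) L2_closure_base one)
      then show ?case
        by (rule L2_closure_cong) (auto split: split_indicator)
    next
      case (union A)
      have sets: "A i \<in> sets M" for i using union(2) unfolding G(3) by blast
      have "(\<lambda>x. indicator (\<Union>i<n. A i) x) \<in> L2_closure M U" for n :: nat
      proof -
        have "(\<lambda>x. \<Sum>i<n. indicator (A i) x) \<in> L2_closure M U" by (intro clo_sum union(3)) auto
        moreover have "(\<lambda>x. \<Sum>i<n. indicator (A i) x) = (indicator (\<Union>i<n. A i) :: 'a \<Rightarrow> complex)"
          using union(1) by (intro ext indicator_UN_disjoint[symmetric])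
            (auto simp: disjoint_family_on_def)
        ultimately show ?thesis by simp
      qed
      then show ?case
      proof (rule L2_closure_limit[where w="\<lambda>_. 1" and s="\<lambda>n. indicator (\<Union>i<n. A i)"])
        show "indicator (\<Union>i. A i) \<in> borel_measurable M" using sets by simp
        show "AE x in M. (\<lambda>n. indicator (\<Union>i<n. A i) x :: complex) \<longlonglongrightarrow> indicator (\<Union>i. A i) x"
          by (rule AE_I2) (rule LIMSEQ_indicator_UN)
      qed (use fin1 in \<open>auto simp: indicator_def\<close>)
    qed
  qed
  have simple: "s \<in> L2_closure M U" if s: "simple_function M s" for s
  proof -
    have [measurable]: "s \<in> borel_measurable M" using s by (rule borel_measurable_simple_function)
    have "(\<lambda>x. \<Sum>y\<in>s ` space M. y * indicator (s -` {y} \<inter> space M) x) \<in> L2_closure M U"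
    proof (rule clo_sum)
      show "finite (s ` space M)" using s by (rule simple_functionD)
      show "(\<lambda>x. y * indicator (s -` {y} \<inter> space M) x) \<in> L2_closure M U" for y
        by (rule clo_cmult[OF ind_sets[OF simple_functionD(2)[OF s]]])
    qed
    then show ?thesis
    proof (rule L2_closure_cong)
      show "AE x in M. s x = (\<Sum>y\<in>s ` space M. y * indicator (s -` {y} \<inter> space M) x)"
      proof (rule AE_I2)
        fix x assume "x \<in> space M"
        then have "s x = (\<Sum>y\<in>s ` space M. indicator (s -` {y} \<inter> space M) x *\<^sub>R y)"
          by (rule simple_function_indicator_representation_banach[OF s])
        also have "\<dots> = (\<Sum>y\<in>s ` space M. y * indicator (s -` {y} \<inter> space M) x)"
          by (intro sum.cong refl) (simp add: indicator_def)
        finally show "s x = \<dots>" .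
      qed
    qed simp
  qed
  obtain s where s: "\<forall>i. simple_function M (s i)" "\<forall>x\<in>space M. (\<lambda>i. s i x) \<longlonglongrightarrow> g x"
    "\<forall>i. \<forall>x\<in>space M. dist (s i x) 0 \<le> 2 * dist (g x) 0"
    using borel_measurable_implies_sequence_metric[OF g, of 0] by blast
  show ?thesis
  proof (rule L2_closure_limit[where s=s and w="\<lambda>x. 2 * cmod (g x)"])
    show "(\<integral>\<^sup>+x. ennreal ((2 * cmod (g x))\<^sup>2) \<partial>M) < \<infinity>"
      using g2 by (simp add: power_mult_distrib ennreal_mult nn_integral_cmult ennreal_mult_less_top)
    show "s n \<in> L2_closure M U" for n using simple s(1) by blast
    show "AE x in M. (\<lambda>n. s n x) \<longlonglongrightarrow> g x" using s(2) by (intro AE_I2) blast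
    show "AE x in M. cmod (s n x) \<le> 2 * cmod (g x)" for n using s(3) by (intro AE_I2) simp
    show "AE x in M. cmod (g x) \<le> 2 * cmod (g x)" by simp
    show "(\<lambda>x. 2 * cmod (g x)) \<in> borel_measurable M" by measurable
  qed (rule g)
qed

end

section \<open>Trigonometric polynomials\<close>

text \<open>The restriction to one period is made by a density, so the underlying space is the whole
  line and Borel functions on it can be used unchanged.\<close>

definition period_measure :: "real \<Rightarrow> real measure" where
  "period_measure b = density lborel (\<lambda>x. ennreal (indicator {0..<b} x))"

lemma sets_period_measure [measurable_cong, simp]: "sets (period_measure b) = sets borel"
  by (simp add: period_measure_def)

lemma space_period_measure [simp]: "space (period_measure b) = UNIV"
  by (simp add: period_measure_def)

lemma measurable_period_measure: "borel_measurable (period_measure b) = borel_measurable borel"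
  by (rule measurable_cong_sets) auto

lemma nn_integral_period_measure:
  "f \<in> borel_measurable borel \<Longrightarrow>
    (\<integral>\<^sup>+x. f x \<partial>period_measure b) = (\<integral>\<^sup>+x. indicator {0..<b} x * f x \<partial>lborel)"
  by (simp add: period_measure_def nn_integral_density ennreal_indicator)

lemma integral_period_measure:
  fixes f :: "real \<Rightarrow> complex"
  assumes "f \<in> borel_measurable borel"
  shows "(\<integral>x. f x \<partial>period_measure b) = (\<integral>x. indicator {0..<b} x *\<^sub>R f x \<partial>lborel)"
  unfolding period_measure_def using assms by (subst integral_density) auto

lemma AE_period_measure: "AE x in period_measure b. x \<in> {0..<b}"
  unfolding period_measure_def by (subst AE_density) (auto simp: indicator_def)

lemma emeasure_period_measure: "0 \<le> b \<Longrightarrow> emeasure (period_measure b) UNIV = ennreal b"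
  using nn_integral_period_measure[of "\<lambda>_. 1" b] by simp

lemma finite_measure_period_measure: "0 \<le> b \<Longrightarrow> finite_measure (period_measure b)"
  by (rule finite_measureI) (simp add: emeasure_period_measure)

definition fexp :: "real \<Rightarrow> int \<Rightarrow> real \<Rightarrow> complex" where
  "fexp b n t = cis (2 * pi * of_int n * t / b)"

lemma continuous_on_fexp [continuous_intros]: "continuous_on A (fexp b n)"
  unfolding fexp_def divide_inverse by (intro continuous_intros)

lemma borel_measurable_fexp [measurable]: "fexp b n \<in> borel_measurable borel"
  by (intro borel_measurable_continuous_onI continuous_intros)

lemma norm_fexp [simp]: "cmod (fexp b n t) = 1"
  by (simp add: fexp_def)

lemma fexp_0 [simp]: "fexp b 0 t = 1"
  by (simp add: fexp_def)

lemma fexp_add: "fexp b (m + n) t = fexp b m t * fexp b n t"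
  by (simp add: fexp_def cis_mult add_divide_distrib algebra_simps)

lemma fexp_minus: "fexp b (- n) t = cnj (fexp b n t)"
  by (simp add: fexp_def cis_cnj)

lemma integral_fexp:
  assumes "0 < b"
  shows "(\<integral>t. fexp b n t \<partial>period_measure b) = (if n = 0 then of_real b else 0)"
proof -
  have "(\<integral>t. fexp b n t \<partial>period_measure b) = (\<integral>t. indicator {0..<b} t *\<^sub>R fexp b n t \<partial>lborel)"
    by (simp add: integral_period_measure)
  also have "\<dots> = (\<integral>t. indicator {0..b} t *\<^sub>R fexp b n t \<partial>lborel)"
    by (intro integral_cong_AE) (auto simp: indicator_def intro!: AE_I[of _ _ "{b}"])
  also have "\<dots> = (if n = 0 then of_real b else 0)"
  proof (cases "n = 0")
    case True
    then show ?thesis using assms by (simp add: scaleR_conv_of_real)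
  next
    case False
    define w where "w = 2 * pi * \<i> * of_int n / of_real b"
    have w: "w \<noteq> 0" using assms False by (simp add: w_def)
    have fexp_w: "fexp b n t = exp (w * of_real t)" for t
      by (simp add: fexp_def cis_conv_exp w_def mult_ac)
    define F where "F t = fexp b n t / w" for t
    have "(\<integral>t. indicator {0..b} t *\<^sub>R fexp b n t \<partial>lborel) = F b - F 0"
    proof (rule integral_FTC_Icc)
      show "(F has_vector_derivative fexp b n t) (at t within {0..b})" for t
      proof -
        have "((\<lambda>z. exp (w * z) / w) has_field_derivative exp (w * of_real t)) (at (of_real t))"
          using w by (auto intro!: derivative_eq_intros)
        then show ?thesis unfolding F_def fexp_w by (rule has_vector_derivative_real_field)
      qed
    qed (use assms in \<open>auto intro: continuous_intros\<close>)
    moreover have "fexp b n b = 1"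
      using assms cis_multiple_2pi[of "of_int n"] by (simp add: fexp_def)
    then have "F b = F 0" by (simp add: F_def) (simp add: fexp_def)
    ultimately show ?thesis using False by simp
  qed
  finally show ?thesis .
qed

text \<open>The closure properties needed for density are built in; the expansion into finitely many
  exponentials is extracted only for the computation with coefficients.\<close>

inductive_set trig_poly :: "real \<Rightarrow> (real \<Rightarrow> complex) set" for b where
  fexp: "fexp b n \<in> trig_poly b"
| cmult: "u \<in> trig_poly b \<Longrightarrow> (\<lambda>t. k * u t) \<in> trig_poly b"
| add: "u \<in> trig_poly b \<Longrightarrow> v \<in> trig_poly b \<Longrightarrow> (\<lambda>t. u t + v t) \<in> trig_poly b"

lemma trig_poly_const: "(\<lambda>_. k) \<in> trig_poly b"
  using trig_poly.cmult[OF trig_poly.fexp[of b 0], of k] by simp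

lemma trig_poly_mult:
  assumes "u \<in> trig_poly b" "v \<in> trig_poly b"
  shows "(\<lambda>t. u t * v t) \<in> trig_poly b"
proof -
  have fexp_mult: "(\<lambda>t. fexp b n t * v t) \<in> trig_poly b" for n
    using assms(2)
  proof induction
    case (fexp m)
    show ?case using trig_poly.fexp[of b "n + m"] by (simp add: fexp_add[abs_def])
  next
    case (cmult u k)
    then show ?case using trig_poly.cmult[of "\<lambda>t. fexp b n t * u t" b k] by (simp add: mult.left_commute)
  next
    case (add u v)
    then show ?case using trig_poly.add by (simp add: distrib_left)
  qed
  show ?thesis using assms(1)
  proof induction
    case (fexp n)
    show ?case by (rule fexp_mult)
  next
    case (cmult u k)
    then show ?case using trig_poly.cmult[of "\<lambda>t. u t * v t" b k] by (simp add: mult.assoc)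
  next
    case (add u v)
    then show ?case using trig_poly.add by (simp add: distrib_right)
  qed
qed

lemma trig_poly_measurable: "u \<in> trig_poly b \<Longrightarrow> u \<in> borel_measurable borel"
  by (induction rule: trig_poly.induct) auto

lemma trig_poly_expansion:
  assumes "u \<in> trig_poly b"
  obtains F d where "finite F" "u = (\<lambda>t. \<Sum>n\<in>F. d n * fexp b n t)"
proof -
  have "\<exists>F d. finite F \<and> u = (\<lambda>t. \<Sum>n\<in>F. d n * fexp b n t)" using assms
  proof induction
    case (fexp n)
    show ?case by (intro exI[of _ "{n}"] exI[of _ "\<lambda>_. 1"]) simp
  next
    case (cmult u k)
    then obtain F d where "finite F" "u = (\<lambda>t. \<Sum>n\<in>F. d n * fexp b n t)" by blast
    then show ?case
      by (intro exI[of _ F] exI[of _ "\<lambda>n. k * d n"]) (simp add: sum_distrib_left mult.assoc)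
  next
    case (add u v)
    then obtain F d G e where F: "finite F" "u = (\<lambda>t. \<Sum>n\<in>F. d n * fexp b n t)"
      and G: "finite G" "v = (\<lambda>t. \<Sum>n\<in>G. e n * fexp b n t)" by blast
    define h where "h n = (if n \<in> F then d n else 0) + (if n \<in> G then e n else 0)" for n
    have "u t + v t = (\<Sum>n\<in>F \<union> G. h n * fexp b n t)" for t
    proof -
      have "u t = (\<Sum>n\<in>F \<union> G. (if n \<in> F then d n else 0) * fexp b n t)"
        unfolding F(2) using F(1) G(1) by (intro sum.mono_neutral_cong_left) auto
      moreover have "v t = (\<Sum>n\<in>F \<union> G. (if n \<in> G then e n else 0) * fexp b n t)"
        unfolding G(2) using F(1) G(1) by (intro sum.mono_neutral_cong_left) auto
      ultimately show ?thesis by (simp add: h_def distrib_right sum.distrib)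
    qed
    then show ?case using F(1) G(1) by (intro exI[of _ "F \<union> G"] exI[of _ h]) auto
  qed
  then show thesis using that by blast
qed

lemma trig_poly_real_polynomial:
  assumes "real_polynomial_function (p :: complex \<Rightarrow> real)"
  shows "(\<lambda>t. of_real (p (fexp b 1 t))) \<in> trig_poly b"
  using assms
proof induction
  case (linear f)
  \<comment> \<open>Euler's formulas: on the unit circle a real-linear \<open>f\<close> is
    \<open>f 1 * cos + f \<i> * sin\<close>, and both functions are combinations of
    \<open>fexp b 1\<close> and \<open>fexp b (- 1)\<close>.\<close>
  have "(of_real (f (fexp b 1 t)) :: complex)
      = (f 1 / 2 - \<i> * f \<i> / 2) * fexp b 1 t + (f 1 / 2 + \<i> * f \<i> / 2) * fexp b (- 1) t" for t
  proof -
    interpret bounded_linear f by fact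
    have "fexp b 1 t = Re (fexp b 1 t) *\<^sub>R 1 + Im (fexp b 1 t) *\<^sub>R \<i>"
      by (simp add: complex_eq_iff)
    then have "f (fexp b 1 t) = Re (fexp b 1 t) * f 1 + Im (fexp b 1 t) * f \<i>"
      by (metis add scaleR real_scaleR_def)
    then show ?thesis by (simp add: fexp_minus complex_eq_iff)
  qed
  then show ?case
    using trig_poly.add[OF trig_poly.cmult[OF trig_poly.fexp] trig_poly.cmult[OF trig_poly.fexp]]
    by presburger
next
  case (const c)
  show ?case by (rule trig_poly_const)
next
  case (add f g)
  then show ?case using trig_poly.add by simp
next
  case (mult f g)
  then show ?case using trig_poly_mult by simp
qed


lemma L2_closure_trig_poly_continuous:
  fixes h :: "complex \<Rightarrow> real"
  assumes "0 < b" and h: "continuous_on UNIV h"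
  shows "(\<lambda>t. of_real (h (fexp b 1 t))) \<in> L2_closure (period_measure b) (trig_poly b)"
  unfolding L2_closure_def
proof (intro CollectI conjI allI impI)
  have [measurable]: "h \<in> borel_measurable borel" using h by (rule borel_measurable_continuous_onI)
  show "(\<lambda>t. complex_of_real (h (fexp b 1 t))) \<in> borel_measurable (period_measure b)" by measurable
  fix \<epsilon> :: real assume "\<epsilon> > 0"
  \<comment> \<open>A uniform error \<open>\<delta>\<close> on the circle costs at most
    \<open>b * \<delta>^2 = \<epsilon> / 2\<close> in squared distance over the period.\<close>
  define \<delta> where "\<delta> = sqrt (\<epsilon> / (2 * b))"
  have "\<delta> > 0" using \<open>\<epsilon> > 0\<close> \<open>0 < b\<close> by (simp add: \<delta>_def)
  obtain p where p: "real_polynomial_function p" "\<And>z. z \<in> sphere 0 1 \<Longrightarrow> \<bar>h z - p z\<bar> < \<delta>"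
    using Stone_Weierstrass_real_polynomial_function[OF compact_sphere continuous_on_subset[OF h] \<open>\<delta> > 0\<close>, of 0 1]
    by blast
  have "dist2 (period_measure b) (\<lambda>t. of_real (h (fexp b 1 t))) (\<lambda>t. of_real (p (fexp b 1 t)))
      \<le> (\<integral>\<^sup>+t. ennreal (\<delta>\<^sup>2) \<partial>period_measure b)"
    unfolding dist2_def
  proof (intro nn_integral_mono ennreal_leI)
    fix t
    have "\<bar>h (fexp b 1 t) - p (fexp b 1 t)\<bar> \<le> \<delta>" using p(2)[of "fexp b 1 t"] by simp
    then show "(cmod (complex_of_real (h (fexp b 1 t)) - complex_of_real (p (fexp b 1 t))))\<^sup>2 \<le> \<delta>\<^sup>2"
      by (intro power_mono) (simp_all add: of_real_diff[symmetric] del: of_real_diff)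
  qed
  also have "\<dots> = ennreal (\<epsilon> / 2)"
    using \<open>0 < b\<close> \<open>\<epsilon> > 0\<close> by (simp add: emeasure_period_measure \<delta>_def ennreal_mult'[symmetric])
  also have "\<dots> < ennreal \<epsilon>" using \<open>\<epsilon> > 0\<close> by (intro ennreal_lessI) auto
  finally show "\<exists>u\<in>trig_poly b. dist2 (period_measure b) (\<lambda>t. of_real (h (fexp b 1 t))) u < ennreal \<epsilon>"
    using trig_poly_real_polynomial[OF p(1)] by blast
qed

lemma fexp_1_inj_on:
  assumes "0 < b"
  shows "inj_on (fexp b 1) {0..<b}"
proof (rule inj_onI)
  fix s t assume st: "s \<in> {0..<b}" "t \<in> {0..<b}" "fexp b 1 s = fexp b 1 t"
  then have "sin (2 * pi * s / b) = sin (2 * pi * t / b) \<and> cos (2 * pi * s / b) = cos (2 * pi * t / b)"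
    by (simp add: fexp_def complex_eq_iff)
  then obtain n :: int where "2 * pi * s / b = 2 * pi * t / b + 2 * pi * of_int n"
    unfolding sin_cos_eq_iff by blast
  then have "2 * pi * s = 2 * pi * (t + of_int n * b)"
    using assms by (simp add: field_simps)
  then have eq: "s = t + of_int n * b" by simp
  have "0 \<le> s" "s < b" "0 \<le> t" "t < b" using st by auto
  with eq have "of_int n * b < 1 * b" "(- 1) * b < of_int n * b" by linarith+
  then have "real_of_int n < 1" "- 1 < real_of_int n" using assms by (simp_all only: mult_less_cancel_right_pos)
  then have "n = 0" by linarith
  then show "s = t" using eq by simp
qed

text \<open>Only the trace of the half-line on \<open>[0, b)\<close> counts. In the main case it is
  \<open>[0, x]\<close>, which \<open>fexp b 1\<close> maps to a closed arc; the indicator of a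
  closed set is a pointwise limit of continuous functions of the distance to it, and injectivity on
  \<open>[0, b)\<close> carries the indicator of the arc back to that of the half-line.\<close>

lemma L2_closure_trig_poly_indicator:
  assumes "0 < b"
  shows "indicator {..x} \<in> L2_closure (period_measure b) (trig_poly b)"
proof -
  let ?C = "L2_closure (period_measure b) (trig_poly b)"
  have meas: "u \<in> trig_poly b \<Longrightarrow> u \<in> borel_measurable (period_measure b)" for u
    by (simp add: trig_poly_measurable measurable_period_measure)
  have ind: "(indicator {..x} :: real \<Rightarrow> complex) \<in> borel_measurable (period_measure b)" by simp
  consider "x < 0" | "0 \<le> x" "x < b" | "b \<le> x" by linarith
  then show ?thesis
  proof cases
    case 1
    have const: "(\<lambda>_. 0) \<in> ?C" by (intro L2_closure_base meas trig_poly_const)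
    show ?thesis
      by (rule L2_closure_cong[OF meas const ind]) (use AE_period_measure[of b] 1 in \<open>auto simp: indicator_def\<close>)
  next
    case 3
    have const: "(\<lambda>_. 1) \<in> ?C" by (intro L2_closure_base meas trig_poly_const)
    show ?thesis
      by (rule L2_closure_cong[OF meas const ind]) (use AE_period_measure[of b] 3 in \<open>auto simp: indicator_def\<close>)
  next
    case 2
    define A where "A = fexp b 1 ` {0..x}"
    have A: "closed A" "A \<noteq> {}"
      using 2 by (auto simp: A_def intro!: compact_imp_closed compact_continuous_image continuous_intros)
    define h where "h n z = max 0 (1 - real n * infdist z A)" for n z
    have h_lim: "(\<lambda>n. h n z) \<longlonglongrightarrow> indicator A z" for z
    proof (cases "z \<in> A")
      case True
      then show ?thesis by (simp add: h_def)
    next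
      case False
      then have "infdist z A > 0"
        using A by (metis in_closed_iff_infdist_zero infdist_nonneg less_eq_real_def)
      then obtain N where N: "1 < real N * infdist z A" using reals_Archimedean3 by blast
      have "h n z = 0" if "n \<ge> N" for n
      proof -
        have "real N * infdist z A \<le> real n * infdist z A"
          using that \<open>infdist z A > 0\<close> by (intro mult_right_mono) auto
        then show ?thesis using N by (simp add: h_def)
      qed
      then have "\<forall>\<^sub>F n in sequentially. h n z = indicator A z"
        using False by (auto simp: eventually_sequentially)
      then show ?thesis by (rule tendsto_eventually)
    qed
    have ind_A: "indicator A (fexp b 1 t) = (indicator {..x} t :: real)" if "t \<in> {0..<b}" for t
    proof -
      have "fexp b 1 t \<in> A \<longleftrightarrow> t \<in> {0..x}"
        unfolding A_def using that 2
        by (intro inj_on_image_mem_iff[OF fexp_1_inj_on[OF \<open>0 < b\<close>]]) auto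
      then show ?thesis using that by (simp add: indicator_def)
    qed
    show ?thesis
    proof (rule L2_closure_limit[OF meas _ ind, where s="\<lambda>n t. of_real (h n (fexp b 1 t))" and w="\<lambda>_. 1"])
      show "(\<lambda>t. of_real (h n (fexp b 1 t))) \<in> ?C" for n
        unfolding h_def by (intro L2_closure_trig_poly_continuous \<open>0 < b\<close> continuous_intros)
      show "AE t in period_measure b.
          (\<lambda>n. complex_of_real (h n (fexp b 1 t))) \<longlonglongrightarrow> indicator {..x} t"
        using AE_period_measure[of b]
      proof eventually_elim
        case (elim t)
        have "(\<lambda>n. complex_of_real (h n (fexp b 1 t))) \<longlonglongrightarrow> of_real (indicator A (fexp b 1 t))"
          by (intro tendsto_of_real h_lim)
        moreover have "complex_of_real (indicator {..x} t) = indicator {..x} t" by (simp add: indicator_def)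
        ultimately show ?case using ind_A[OF elim] by simp
      qed
      show "(\<integral>\<^sup>+ t. ennreal (1\<^sup>2) \<partial>period_measure b) < \<infinity>"
        using \<open>0 < b\<close> by (simp add: emeasure_period_measure)
      show "AE t in period_measure b. cmod (of_real (h n (fexp b 1 t))) \<le> 1" for n
        by (auto simp: h_def infdist_nonneg)
    qed (auto simp: indicator_def)
  qed
qed

lemma L2_closure_trig_poly:
  assumes "0 < b" and g: "g \<in> borel_measurable borel"
    and g2: "(\<integral>\<^sup>+x. ennreal ((cmod (g x))\<^sup>2) \<partial>period_measure b) < \<infinity>"
  shows "g \<in> L2_closure (period_measure b) (trig_poly b)"
proof (rule L2_closure_eq_L2[where G="range atMost"])
  show "sets (period_measure b) = sigma_sets (space (period_measure b)) (range atMost)"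
    by (simp add: borel_eq_atMost)
  show "Int_stable (range atMost :: real set set)"
    by (auto simp: Int_stable_def)
  show "finite_measure (period_measure b)" using assms by (simp add: finite_measure_period_measure)
  show "indicator A \<in> L2_closure (period_measure b) (trig_poly b)" if "A \<in> range atMost" for A
    using that L2_closure_trig_poly_indicator[OF \<open>0 < b\<close>] by auto
qed (use g g2 in \<open>auto simp: measurable_period_measure trig_poly_measurable trig_poly_const intro: trig_poly.intros\<close>)

section \<open>Parseval's identity\<close>

text \<open>Reduces sums over \<open>int\<close> to a countable supremum of finite sums; this lets
  Bessel's inequality pass to the full sum and makes such sums measurable in a parameter.\<close>

lemma nn_integral_count_space_int:
  fixes f :: "int \<Rightarrow> ennreal"
  shows "(\<integral>\<^sup>+n. f n \<partial>count_space UNIV) = (SUP N. \<Sum>n\<in>{- int N..int N}. f n)"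
proof -
  have "(\<integral>\<^sup>+n. f n \<partial>count_space UNIV)
      = (\<integral>\<^sup>+n. (SUP N. f n * indicator {- int N..int N} n) \<partial>count_space UNIV)"
  proof (rule nn_integral_cong)
    fix n
    show "f n = (SUP N. f n * indicator {- int N..int N} n)"
    proof (rule antisym)
      have "f n = f n * indicator {- int (nat \<bar>n\<bar>)..int (nat \<bar>n\<bar>)} n" by (auto simp: indicator_def)
      also have "\<dots> \<le> (SUP N. f n * indicator {- int N..int N} n)" by (rule SUP_upper) simp
      finally show "f n \<le> (SUP N. f n * indicator {- int N..int N} n)" .
      show "(SUP N. f n * indicator {- int N..int N} n) \<le> f n"
        by (rule SUP_least) (auto simp: indicator_def)
    qed
  qed
  also have "\<dots> = (SUP N. \<integral>\<^sup>+n. f n * indicator {- int N..int N} n \<partial>count_space UNIV)"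
    by (intro nn_integral_monotone_convergence_SUP)
       (auto simp: incseq_def le_fun_def indicator_def)
  also have "\<dots> = (SUP N. \<Sum>n\<in>{- int N..int N}. f n)"
  proof (rule SUP_cong[OF refl])
    fix N
    show "(\<integral>\<^sup>+n. f n * indicator {- int N..int N} n \<partial>count_space UNIV) = (\<Sum>n\<in>{- int N..int N}. f n)"
      by (subst nn_integral_count_space'[of "{- int N..int N}"]) (auto simp: indicator_def)
  qed
  finally show ?thesis .
qed

lemma sum_le_nn_integral_count_space:
  assumes "finite F"
  shows "(\<Sum>n\<in>F. f n) \<le> (\<integral>\<^sup>+n. f n \<partial>count_space UNIV)"
proof -
  have "(\<Sum>n\<in>F. f n) = (\<integral>\<^sup>+n. f n * indicator F n \<partial>count_space UNIV)"
    using assms by (subst nn_integral_count_space'[of F]) (auto simp: indicator_def)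
  also have "\<dots> \<le> (\<integral>\<^sup>+n. f n \<partial>count_space UNIV)"
    by (intro nn_integral_mono) (auto simp: indicator_def)
  finally show ?thesis .
qed

context
  fixes b :: real and g :: "real \<Rightarrow> complex"
  assumes b: "0 < b" and g [measurable]: "g \<in> borel_measurable borel"
    and g2: "(\<integral>\<^sup>+x. ennreal ((cmod (g x))\<^sup>2) \<partial>period_measure b) < \<infinity>"
begin

interpretation finite_measure "period_measure b"
  using b by (intro finite_measure_period_measure) simp

lemma integrable_norm_sq: "integrable (period_measure b) (\<lambda>t. (cmod (g t))\<^sup>2)"
  using g2 by (intro integrableI_bounded) (auto simp: measurable_period_measure)

lemma integrable_mult_cnj: "integrable (period_measure b) (\<lambda>t. g t * cnj (g t))"
  using integrable_norm_sq unfolding complex_norm_square[symmetric] by (rule integrable_of_real)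

lemma integrable_bounded_mult:
  assumes [measurable]: "h \<in> borel_measurable borel" and h: "\<And>t. cmod (h t) \<le> C"
  shows "integrable (period_measure b) (\<lambda>t. g t * h t)"
proof (rule Bochner_Integration.integrable_bound)
  show "integrable (period_measure b) (\<lambda>t. C * (1 + (cmod (g t))\<^sup>2))"
    using integrable_norm_sq by auto
  show "(\<lambda>t. g t * h t) \<in> borel_measurable (period_measure b)" by (simp add: measurable_period_measure)
  show "AE t in period_measure b. norm (g t * h t) \<le> norm (C * (1 + (cmod (g t))\<^sup>2))"
  proof (rule AE_I2)
    fix t
    have "C \<ge> 0" using h[of t] norm_ge_zero order_trans by blast
    have "cmod (g t) \<le> 1 + (cmod (g t))\<^sup>2"
      using sum_squares_bound[of "cmod (g t)" 1] by (smt (verit) mult_cancel_left1 norm_ge_zero one_power2 power2_eq_square)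
    then have "cmod (h t) * cmod (g t) \<le> C * (1 + (cmod (g t))\<^sup>2)"
      using h \<open>C \<ge> 0\<close> by (intro mult_mono) auto
    then show "norm (g t * h t) \<le> norm (C * (1 + (cmod (g t))\<^sup>2))"
      by (simp add: norm_mult mult.commute)
  qed
qed

text \<open>Not divided by the length \<open>b\<close>: when \<open>g\<close> is a
  \<open>row_fun\<close>, it is then, up to the sign of \<open>n\<close>, the inner product with a
  Gabor atom. As \<open>fexp b n\<close> has squared norm \<open>b\<close>, the best approximating
  coefficient is \<open>fcoeff n / b\<close>.\<close>

definition fcoeff :: "int \<Rightarrow> complex" where
  "fcoeff n = (\<integral>t. g t * cnj (fexp b n t) \<partial>period_measure b)"

text \<open>The square is completed in each coefficient. With \<open>d n = fcoeff n / b\<close> the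
  identity yields Bessel's inequality; for arbitrary \<open>d\<close>, dropping the nonnegative last
  sum bounds the missing mass by the approximation error.\<close>

lemma fourier_approx_identity:
  assumes "finite F"
  shows "(\<integral>t. (cmod (g t - (\<Sum>n\<in>F. d n * fexp b n t)))\<^sup>2 \<partial>period_measure b)
    = (\<integral>t. (cmod (g t))\<^sup>2 \<partial>period_measure b) - (\<Sum>n\<in>F. (cmod (fcoeff n))\<^sup>2) / b
      + b * (\<Sum>n\<in>F. (cmod (d n - fcoeff n / of_real b))\<^sup>2)"
proof -
  let ?M = "period_measure b"
  let ?p = "\<lambda>t. \<Sum>n\<in>F. d n * fexp b n t"
  have int_e: "integrable ?M (\<lambda>t. g t * cnj (fexp b n t))" for n
    unfolding fexp_minus[symmetric] by (rule integrable_bounded_mult[where C=1]) auto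
  have int_ce: "integrable ?M (\<lambda>t. cnj (g t) * fexp b n t)" for n
    using integrable_cnj[OF int_e[of n]] by simp
  have coeff_cnj: "(\<integral>t. cnj (g t) * fexp b n t \<partial>?M) = cnj (fcoeff n)" for n
    using Bochner_Integration.integral_cnj[of ?M "\<lambda>t. g t * cnj (fexp b n t)"] by (simp add: fcoeff_def)
  have int_ee: "integrable ?M (fexp b n)" for n
    by (rule integrable_const_bound[where B=1]) (auto simp: measurable_period_measure)
  have ee: "fexp b n t * cnj (fexp b m t) = fexp b (n - m) t" for n m t
    using fexp_add[of b n "- m" t] by (simp add: fexp_minus)
  have gp: "g t * cnj (?p t) = (\<Sum>n\<in>F. cnj (d n) * (g t * cnj (fexp b n t)))" for t
    by (simp add: sum_distrib_left mult_ac)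
  have pg: "?p t * cnj (g t) = (\<Sum>n\<in>F. d n * (cnj (g t) * fexp b n t))" for t
    unfolding sum_distrib_right by (intro sum.cong refl) (simp add: mult_ac)
  have pp: "?p t * cnj (?p t) = (\<Sum>n\<in>F. \<Sum>m\<in>F. (d n * cnj (d m)) * fexp b (n - m) t)" for t
    unfolding ee[symmetric] by (simp add: sum_product mult_ac)
  have int_gp: "integrable ?M (\<lambda>t. g t * cnj (?p t))"
    unfolding gp by (intro Bochner_Integration.integrable_sum integrable_mult_right int_e)
  have int_pg: "integrable ?M (\<lambda>t. ?p t * cnj (g t))"
    unfolding pg by (intro Bochner_Integration.integrable_sum integrable_mult_right int_ce)
  have int_pp: "integrable ?M (\<lambda>t. ?p t * cnj (?p t))"
    unfolding pp by (intro Bochner_Integration.integrable_sum integrable_mult_right int_ee)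
  have I_gp: "(\<integral>t. g t * cnj (?p t) \<partial>?M) = (\<Sum>n\<in>F. cnj (d n) * fcoeff n)"
    unfolding gp fcoeff_def by (simp add: int_e)
  have I_pg: "(\<integral>t. ?p t * cnj (g t) \<partial>?M) = (\<Sum>n\<in>F. d n * cnj (fcoeff n))"
    unfolding pg coeff_cnj[symmetric] by (simp add: int_ce)
  have I_pp: "(\<integral>t. ?p t * cnj (?p t) \<partial>?M) = (\<Sum>n\<in>F. d n * cnj (d n) * of_real b)"
  proof -
    have "(\<integral>t. ?p t * cnj (?p t) \<partial>?M)
        = (\<Sum>n\<in>F. \<Sum>m\<in>F. (d n * cnj (d m)) * (\<integral>t. fexp b (n - m) t \<partial>?M))"
      unfolding pp by (simp add: int_ee)
    also have "\<dots> = (\<Sum>n\<in>F. \<Sum>m\<in>F. if m = n then d n * cnj (d n) * of_real b else 0)"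
      by (intro sum.cong refl) (auto simp: integral_fexp[OF b])
    also have "\<dots> = (\<Sum>n\<in>F. d n * cnj (d n) * of_real b)" using assms by simp
    finally show ?thesis .
  qed
  have "complex_of_real (\<integral>t. (cmod (g t - ?p t))\<^sup>2 \<partial>?M)
      = (\<integral>t. (g t - ?p t) * cnj (g t - ?p t) \<partial>?M)"
    unfolding complex_norm_square[symmetric] by (simp only: integral_complex_of_real)
  also have "\<dots> = (\<integral>t. g t * cnj (g t) - g t * cnj (?p t) - ?p t * cnj (g t) + ?p t * cnj (?p t) \<partial>?M)"
    by (intro Bochner_Integration.integral_cong refl) (simp only: complex_cnj_diff, algebra)
  also have "\<dots> = (\<integral>t. g t * cnj (g t) \<partial>?M) - (\<Sum>n\<in>F. cnj (d n) * fcoeff n)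
      - (\<Sum>n\<in>F. d n * cnj (fcoeff n)) + (\<Sum>n\<in>F. d n * cnj (d n) * of_real b)"
    unfolding I_gp[symmetric] I_pg[symmetric] I_pp[symmetric]
    using integrable_mult_cnj int_gp int_pg int_pp by simp
  also have "(\<integral>t. g t * cnj (g t) \<partial>?M) = complex_of_real (\<integral>t. (cmod (g t))\<^sup>2 \<partial>?M)"
    unfolding complex_norm_square[symmetric] by (simp only: integral_complex_of_real)
  finally have *: "complex_of_real (\<integral>t. (cmod (g t - ?p t))\<^sup>2 \<partial>?M) = complex_of_real (\<integral>t. (cmod (g t))\<^sup>2 \<partial>?M)
      + (\<Sum>n\<in>F. d n * cnj (d n) * of_real b - cnj (d n) * fcoeff n - d n * cnj (fcoeff n))"
    by (simp add: sum_subtractf sum.distrib algebra_simps)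
  have "d n * cnj (d n) * of_real b - cnj (d n) * fcoeff n - d n * cnj (fcoeff n)
      = of_real (b * (cmod (d n - fcoeff n / of_real b))\<^sup>2 - (cmod (fcoeff n))\<^sup>2 / b)" for n
    using b by (simp only: of_real_diff of_real_mult of_real_divide complex_norm_square complex_cnj_diff
        complex_cnj_divide complex_cnj_complex_of_real) (simp add: field_simps)
  then have "complex_of_real (\<integral>t. (cmod (g t - ?p t))\<^sup>2 \<partial>?M) = complex_of_real ((\<integral>t. (cmod (g t))\<^sup>2 \<partial>?M)
      + (\<Sum>n\<in>F. b * (cmod (d n - fcoeff n / of_real b))\<^sup>2 - (cmod (fcoeff n))\<^sup>2 / b))"
    unfolding * by simp
  then show ?thesis unfolding of_real_eq_iff
    by (simp add: sum_subtractf sum_distrib_left sum_divide_distrib)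
qed

lemma parseval_fcoeff:
  "(\<integral>\<^sup>+n. ennreal ((cmod (fcoeff n))\<^sup>2) \<partial>count_space UNIV)
    = ennreal b * (\<integral>\<^sup>+t. ennreal ((cmod (g t))\<^sup>2) \<partial>period_measure b)"
proof -
  let ?M = "period_measure b"
  define I where "I = (\<integral>t. (cmod (g t))\<^sup>2 \<partial>?M)"
  have I: "(\<integral>\<^sup>+t. ennreal ((cmod (g t))\<^sup>2) \<partial>?M) = ennreal I"
    unfolding I_def by (rule nn_integral_eq_integral[OF integrable_norm_sq]) simp
  have "I \<ge> 0" by (simp add: I_def)
  have bessel: "(\<Sum>n\<in>F. (cmod (fcoeff n))\<^sup>2) \<le> b * I" if "finite F" for F
  proof -
    have "0 \<le> (\<integral>t. (cmod (g t - (\<Sum>n\<in>F. (fcoeff n / of_real b) * fexp b n t)))\<^sup>2 \<partial>?M)" by simp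
    also have "\<dots> = I - (\<Sum>n\<in>F. (cmod (fcoeff n))\<^sup>2) / b"
      by (subst fourier_approx_identity[OF that]) (simp add: I_def)
    finally show ?thesis using b by (simp add: field_simps)
  qed
  show ?thesis
  proof (rule antisym)
    show "(\<integral>\<^sup>+n. ennreal ((cmod (fcoeff n))\<^sup>2) \<partial>count_space UNIV) \<le> ennreal b * (\<integral>\<^sup>+t. ennreal ((cmod (g t))\<^sup>2) \<partial>?M)"
      unfolding nn_integral_count_space_int I
      using bessel b \<open>I \<ge> 0\<close> by (intro SUP_least) (simp add: sum_ennreal ennreal_mult[symmetric] ennreal_leI)
    show "ennreal b * (\<integral>\<^sup>+t. ennreal ((cmod (g t))\<^sup>2) \<partial>?M) \<le> (\<integral>\<^sup>+n. ennreal ((cmod (fcoeff n))\<^sup>2) \<partial>count_space UNIV)"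
    proof (rule ennreal_le_epsilon)
      fix e :: real assume "e > 0"
      have "e / b > 0" using \<open>e > 0\<close> b by simp
      \<comment> \<open>A squared error below \<open>e / b\<close> leaves, by the approximation
        identity, a gap below \<open>e\<close> between \<open>b * I\<close> and a finite sum of
        squared coefficients.\<close>
      obtain u where u: "u \<in> trig_poly b" "dist2 ?M g u < ennreal (e / b)"
        using L2_closure_trig_poly[OF b g g2] \<open>e / b > 0\<close>
        unfolding L2_closure_def by blast
      obtain F d where F: "finite F" and ud: "u = (\<lambda>t. \<Sum>n\<in>F. d n * fexp b n t)"
        using u(1) by (rule trig_poly_expansion)
      have [measurable]: "u \<in> borel_measurable borel" using u(1) by (rule trig_poly_measurable)
      have int: "integrable ?M (\<lambda>t. (cmod (g t - u t))\<^sup>2)"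
        using u(2) unfolding dist2_def
        by (intro integrableI_bounded) (auto simp: measurable_period_measure intro: order.strict_trans)
      have "ennreal (\<integral>t. (cmod (g t - u t))\<^sup>2 \<partial>?M) < ennreal (e / b)"
        using u(2) unfolding dist2_def by (subst (asm) nn_integral_eq_integral[OF int]) auto
      then have "(\<integral>t. (cmod (g t - u t))\<^sup>2 \<partial>?M) < e / b" by (simp add: ennreal_less_iff)
      then have "I - (\<Sum>n\<in>F. (cmod (fcoeff n))\<^sup>2) / b
          + b * (\<Sum>n\<in>F. (cmod (d n - fcoeff n / of_real b))\<^sup>2) < e / b"
        unfolding ud fourier_approx_identity[OF F] I_def .
      moreover have "b * (\<Sum>n\<in>F. (cmod (d n - fcoeff n / of_real b))\<^sup>2) \<ge> 0"
        using b by (intro mult_nonneg_nonneg sum_nonneg) auto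
      ultimately have "I - (\<Sum>n\<in>F. (cmod (fcoeff n))\<^sup>2) / b < e / b" by linarith
      then have "(I - (\<Sum>n\<in>F. (cmod (fcoeff n))\<^sup>2) / b) * b < e" using b by (simp add: pos_less_divide_eq)
      then have "b * I \<le> (\<Sum>n\<in>F. (cmod (fcoeff n))\<^sup>2) + e" using b by (simp add: right_diff_distrib mult.commute)
      then have "ennreal (b * I) \<le> ennreal (\<Sum>n\<in>F. (cmod (fcoeff n))\<^sup>2) + ennreal e"
        using \<open>e > 0\<close> by (subst ennreal_plus[symmetric]) (auto intro!: sum_nonneg ennreal_leI)
      also have "ennreal (\<Sum>n\<in>F. (cmod (fcoeff n))\<^sup>2) = (\<Sum>n\<in>F. ennreal ((cmod (fcoeff n))\<^sup>2))"
        by (simp add: sum_ennreal)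
      also have "\<dots> \<le> (\<integral>\<^sup>+n. ennreal ((cmod (fcoeff n))\<^sup>2) \<partial>count_space UNIV)"
        using F by (rule sum_le_nn_integral_count_space)
      finally show "ennreal b * (\<integral>\<^sup>+t. ennreal ((cmod (g t))\<^sup>2) \<partial>?M)
          \<le> (\<integral>\<^sup>+n. ennreal ((cmod (fcoeff n))\<^sup>2) \<partial>count_space UNIV) + ennreal e"
        unfolding I using b \<open>I \<ge> 0\<close> by (simp add: ennreal_mult add_right_mono)
    qed
  qed
qed

text \<open>The Gabor atoms are modulated with the opposite sign, so conjugation leaves
  \<open>fexp b n\<close> itself in the integrand; reindexing by \<open>- n\<close> absorbs
  this.\<close>

lemma parseval:
  "(\<integral>\<^sup>+n. ennreal ((cmod (\<integral>t. g t * fexp b n t \<partial>period_measure b))\<^sup>2) \<partial>count_space UNIV)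
    = ennreal b * (\<integral>\<^sup>+t. ennreal ((cmod (g t))\<^sup>2) \<partial>period_measure b)"
proof -
  have "bij_betw uminus (UNIV :: int set) UNIV" by (rule bij_uminus)
  then have "(\<integral>\<^sup>+n. ennreal ((cmod (fcoeff (- n)))\<^sup>2) \<partial>count_space UNIV)
      = (\<integral>\<^sup>+n. ennreal ((cmod (fcoeff n))\<^sup>2) \<partial>count_space UNIV)"
    by (rule nn_integral_bij_count_space)
  then show ?thesis unfolding parseval_fcoeff by (simp add: fcoeff_def fexp_minus)
qed

end

section \<open>Periodization\<close>

lemma cmod_sum_sq_le: "(cmod (\<Sum>i\<in>I. x i))\<^sup>2 \<le> real (card I) * (\<Sum>i\<in>I. (cmod (x i))\<^sup>2)"
proof -
  have "(cmod (\<Sum>i\<in>I. x i))\<^sup>2 \<le> (\<Sum>i\<in>I. cmod (x i))\<^sup>2" by (intro power_mono norm_sum) simp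
  also have "\<dots> \<le> (\<Sum>i\<in>I. (cmod (x i))\<^sup>2) * real (card I)" by (rule sum_squared_le_sum_of_squares)
  finally show ?thesis by (simp add: mult.commute)
qed

lemma mem_period_iff:
  fixes b t :: real
  assumes "0 < b"
  shows "t - of_int k * b \<in> {0..<b} \<longleftrightarrow> k = \<lfloor>t / b\<rfloor>"
proof -
  have "k = \<lfloor>t / b\<rfloor> \<longleftrightarrow> of_int k \<le> t / b \<and> t / b < of_int k + 1" by (subst eq_commute) (rule floor_eq_iff)
  also have "\<dots> \<longleftrightarrow> t - of_int k * b \<in> {0..<b}"
    using assms by (auto simp: pos_le_divide_eq pos_divide_less_eq algebra_simps)
  finally show ?thesis by simp
qed

lemma nn_integral_periodize:
  fixes h :: "real \<Rightarrow> ennreal"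
  assumes "0 < b" and [measurable]: "h \<in> borel_measurable borel"
  shows "(\<integral>\<^sup>+t. h t \<partial>lborel)
    = (\<integral>\<^sup>+t. (\<integral>\<^sup>+k. h (t + of_int k * b) \<partial>count_space (UNIV :: int set)) \<partial>period_measure b)"
proof -
  have "(\<integral>\<^sup>+t. h t \<partial>lborel)
      = (\<integral>\<^sup>+t. (\<integral>\<^sup>+k. indicator {0..<b} (t - of_int k * b) * h t \<partial>count_space (UNIV :: int set)) \<partial>lborel)"
  proof (intro nn_integral_cong)
    fix t
    show "h t = (\<integral>\<^sup>+k. indicator {0..<b} (t - of_int k * b) * h t \<partial>count_space (UNIV :: int set))"
      using assms(1) by (subst nn_integral_count_space'[of "{\<lfloor>t / b\<rfloor>}"])
        (auto simp: indicator_def mem_period_iff simp del: atLeastLessThan_iff)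
  qed
  also have "\<dots> = (\<integral>\<^sup>+k. (\<integral>\<^sup>+t. indicator {0..<b} (t - of_int k * b) * h t \<partial>lborel) \<partial>count_space (UNIV :: int set))"
    by (rule nn_integral_count_space_nn_integral) auto
  also have "\<dots> = (\<integral>\<^sup>+k. (\<integral>\<^sup>+t. h (t + of_int k * b) \<partial>period_measure b) \<partial>count_space (UNIV :: int set))"
  proof (intro nn_integral_cong)
    fix k :: int
    show "(\<integral>\<^sup>+t. indicator {0..<b} (t - of_int k * b) * h t \<partial>lborel) = (\<integral>\<^sup>+t. h (t + of_int k * b) \<partial>period_measure b)"
      using nn_integral_real_affine[of "\<lambda>t. indicator {0..<b} (t - of_int k * b) * h t" 1 "of_int k * b"]
      by (simp add: nn_integral_period_measure add.commute)
  qed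
  also have "\<dots> = (\<integral>\<^sup>+t. (\<integral>\<^sup>+k. h (t + of_int k * b) \<partial>count_space (UNIV :: int set)) \<partial>period_measure b)"
    by (rule nn_integral_count_space_nn_integral[symmetric]) (auto simp: measurable_period_measure)
  finally show ?thesis .
qed

text \<open>The windows are bounded, so the functions in question meet only finitely many periods; a
  finite sum avoids any exchange of an infinite sum with the Bochner integral.\<close>

lemma integral_periodize:
  fixes h :: "real \<Rightarrow> complex"
  assumes "0 < b" and h: "integrable lborel h" and K: "finite K"
    and supp: "\<And>t. h t \<noteq> 0 \<Longrightarrow> \<lfloor>t / b\<rfloor> \<in> K"
  shows "(\<integral>t. h t \<partial>lborel) = (\<integral>t. (\<Sum>k\<in>K. h (t + of_int k * b)) \<partial>period_measure b)"
proof -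
  have [measurable]: "h \<in> borel_measurable borel" using borel_measurable_integrable[OF h] by simp
  have split: "h t = (\<Sum>k\<in>K. indicator {0..<b} (t - of_int k * b) *\<^sub>R h t)" for t
  proof -
    have "(\<Sum>k\<in>K. indicator {0..<b} (t - of_int k * b) *\<^sub>R h t) = (\<Sum>k\<in>K. if k = \<lfloor>t / b\<rfloor> then h t else 0)"
      using assms(1) by (intro sum.cong refl) (auto simp: indicator_def mem_period_iff simp del: atLeastLessThan_iff)
    also have "\<dots> = h t" using supp[of t] K by auto
    finally show ?thesis by simp
  qed
  have int: "integrable lborel (\<lambda>t. indicator {0..<b} (t - of_int k * b) *\<^sub>R h t)" for k :: int
    by (rule Bochner_Integration.integrable_bound[OF h]) (auto simp: indicator_def)
  have int': "integrable lborel (\<lambda>t. indicator {0..<b} t *\<^sub>R h (t + of_int k * b))" for k :: int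
    using lborel_integrable_real_affine[OF int[of k], of 1 "of_int k * b"] by (simp add: add.commute)
  have "(\<integral>t. h t \<partial>lborel) = (\<integral>t. (\<Sum>k\<in>K. indicator {0..<b} (t - of_int k * b) *\<^sub>R h t) \<partial>lborel)"
    using split by (rule Bochner_Integration.integral_cong[OF refl])
  also have "\<dots> = (\<Sum>k\<in>K. \<integral>t. indicator {0..<b} (t - of_int k * b) *\<^sub>R h t \<partial>lborel)"
    by (rule Bochner_Integration.integral_sum) (rule int)
  also have "\<dots> = (\<Sum>k\<in>K. \<integral>t. indicator {0..<b} t *\<^sub>R h (t + of_int k * b) \<partial>lborel)"
  proof (rule sum.cong[OF refl])
    fix k
    show "(\<integral>t. indicator {0..<b} (t - of_int k * b) *\<^sub>R h t \<partial>lborel) = (\<integral>t. indicator {0..<b} t *\<^sub>R h (t + of_int k * b) \<partial>lborel)"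
      using lborel_integral_real_affine[of 1 "\<lambda>t. indicator {0..<b} (t - of_int k * b) *\<^sub>R h t" "of_int k * b"]
      by (simp add: add.commute)
  qed
  also have "\<dots> = (\<integral>t. (\<Sum>k\<in>K. indicator {0..<b} t *\<^sub>R h (t + of_int k * b)) \<partial>lborel)"
    by (rule Bochner_Integration.integral_sum[symmetric]) (rule int')
  also have "\<dots> = (\<integral>t. (\<Sum>k\<in>K. h (t + of_int k * b)) \<partial>period_measure b)"
    by (subst integral_period_measure) (auto simp: scaleR_sum_right)
  finally show ?thesis .
qed

lemma fexp_periodic: "0 < b \<Longrightarrow> fexp b n (t + of_int k * b) = fexp b n t"
proof -
  assume "0 < b"
  then have "2 * pi * of_int n * (t + of_int k * b) / b = 2 * pi * of_int n * t / b + 2 * pi * of_int (n * k)"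
    by (simp add: field_simps)
  then have "fexp b n (t + of_int k * b) = fexp b n t * cis (2 * pi * of_int (n * k))"
    unfolding fexp_def by (simp only: cis_mult)
  then show ?thesis using cis_multiple_2pi[of "of_int (n * k)"] by simp
qed

section \<open>Gabor coefficients as Fourier coefficients of row sums\<close>

context abc
begin

abbreviation chi :: "real \<Rightarrow> complex" where
  "chi \<equiv> \<lambda>t. indicator {0..<c} t"

definition gabor_sum :: "(real \<Rightarrow> complex) \<Rightarrow> ennreal" where
  "gabor_sum f = (\<integral>\<^sup>+mn. ennreal ((cmod (L2_inner f (gabor_atom chi a b mn)))\<^sup>2) \<partial>count_space UNIV)"

text \<open>\<open>row t m\<close> varies with \<open>t\<close>, but for \<open>t\<close> in one
  period it stays inside this finite set; summing over the fixed set makes \<open>row_fun\<close>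
  visibly measurable in \<open>t\<close>.\<close>

definition col_range :: "int \<Rightarrow> int set" where
  "col_range m = {k. of_int m * a - b \<le> of_int k * b \<and> of_int k * b \<le> of_int m * a - b + (c + b)}"

lemma finite_col_range [simp]: "finite (col_range m)"
  unfolding col_range_def using b_pos c_pos by (intro bounded_int_interval_card) auto

lemma row_subset_col_range: "t \<in> {0..<b} \<Longrightarrow> row t m \<subseteq> col_range m"
  by (auto simp: mem_row_iff col_range_def)

definition row_fun :: "(real \<Rightarrow> complex) \<Rightarrow> int \<Rightarrow> real \<Rightarrow> complex" where
  "row_fun f m t = (\<Sum>k\<in>col_range m. f (t + of_int k * b) * chi (t - of_int m * a + of_int k * b))"

lemma row_fun_eq: "t \<in> {0..<b} \<Longrightarrow> row_fun f m t = (\<Sum>k\<in>row t m. f (t + of_int k * b))"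
  unfolding row_fun_def using row_subset_col_range
  by (intro sum.mono_neutral_cong_right) (auto simp: mem_row_iff indicator_def)

context
  fixes f :: "real \<Rightarrow> complex"
  assumes f: "f \<in> L2"
begin

lemma L2_measurable [measurable]: "f \<in> borel_measurable borel"
  using f by (simp add: L2_def)

lemma measurable_row_fun [measurable]: "row_fun f m \<in> borel_measurable borel"
  unfolding row_fun_def by measurable

lemma L2_normsq_eq:
  "ennreal (L2_normsq f)
    = (\<integral>\<^sup>+t. (\<integral>\<^sup>+k. ennreal ((cmod (f (t + of_int k * b)))\<^sup>2) \<partial>count_space (UNIV :: int set)) \<partial>period_measure b)"
proof -
  have "ennreal (L2_normsq f) = (\<integral>\<^sup>+t. ennreal ((cmod (f t))\<^sup>2) \<partial>lborel)"
    unfolding L2_normsq_def using f by (intro nn_integral_eq_integral[symmetric]) (auto simp: L2_def)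
  then show ?thesis
    using nn_integral_periodize[OF b_pos, of "\<lambda>t. ennreal ((cmod (f t))\<^sup>2)"] by simp
qed

lemma nn_integral_translates_measurable:
  "(\<lambda>t. \<integral>\<^sup>+k. ennreal ((cmod (f (t + of_int k * b)))\<^sup>2) \<partial>count_space (UNIV :: int set))
    \<in> borel_measurable (period_measure b)"
  unfolding nn_integral_count_space_int measurable_period_measure by measurable

lemma row_fun_square_integrable: "(\<integral>\<^sup>+t. ennreal ((cmod (row_fun f m t))\<^sup>2) \<partial>period_measure b) < \<infinity>"
proof -
  let ?X = "\<lambda>t. \<integral>\<^sup>+k. ennreal ((cmod (f (t + of_int k * b)))\<^sup>2) \<partial>count_space (UNIV :: int set)"
  have "(\<integral>\<^sup>+t. ennreal ((cmod (row_fun f m t))\<^sup>2) \<partial>period_measure b)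
      \<le> (\<integral>\<^sup>+t. of_nat (card (col_range m)) * ?X t \<partial>period_measure b)"
  proof (rule nn_integral_mono)
    fix t
    have "(cmod (row_fun f m t))\<^sup>2
        \<le> real (card (col_range m)) * (\<Sum>k\<in>col_range m. (cmod (f (t + of_int k * b) * chi (t - of_int m * a + of_int k * b)))\<^sup>2)"
      unfolding row_fun_def by (rule cmod_sum_sq_le)
    also have "\<dots> \<le> real (card (col_range m)) * (\<Sum>k\<in>col_range m. (cmod (f (t + of_int k * b)))\<^sup>2)"
      by (intro mult_left_mono sum_mono) (auto simp: indicator_def)
    finally have "ennreal ((cmod (row_fun f m t))\<^sup>2)
        \<le> ennreal (real (card (col_range m)) * (\<Sum>k\<in>col_range m. (cmod (f (t + of_int k * b)))\<^sup>2))"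
      by (rule ennreal_leI)
    also have "\<dots> = of_nat (card (col_range m)) * (\<Sum>k\<in>col_range m. ennreal ((cmod (f (t + of_int k * b)))\<^sup>2))"
      by (simp add: ennreal_mult sum_nonneg sum_ennreal ennreal_of_nat_eq_real_of_nat)
    also have "\<dots> \<le> of_nat (card (col_range m)) * ?X t"
      by (intro mult_left_mono sum_le_nn_integral_count_space) auto
    finally show "ennreal ((cmod (row_fun f m t))\<^sup>2) \<le> of_nat (card (col_range m)) * ?X t" .
  qed
  also have "\<dots> = of_nat (card (col_range m)) * ennreal (L2_normsq f)"
    unfolding L2_normsq_eq by (rule nn_integral_cmult) (rule nn_integral_translates_measurable)
  also have "\<dots> < \<infinity>" by (simp add: ennreal_mult_less_top of_nat_less_top)
  finally show ?thesis .
qed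

text \<open>The modulation has period \<open>b\<close>, so it factors out when the integral is
  folded onto one period, and what remains is the row sum of the samples.\<close>

lemma L2_inner_gabor_atom:
  "L2_inner f (gabor_atom chi a b (m, n)) = (\<integral>t. row_fun f m t * fexp b n t \<partial>period_measure b)"
proof -
  define h where "h t = f t * (fexp b n t * chi (t - of_int m * a))" for t
  have [measurable]: "h \<in> borel_measurable borel" unfolding h_def by measurable
  have "f t * cnj (gabor_atom chi a b (m, n) t) = h t" for t
    by (simp add: h_def gabor_atom_def fexp_def cis_conv_exp exp_cnj indicator_def mult_ac)
  then have "L2_inner f (gabor_atom chi a b (m, n)) = (\<integral>t. h t \<partial>lborel)"
    by (simp add: L2_inner_def)
  also have "\<dots> = (\<integral>t. (\<Sum>k\<in>col_range m. h (t + of_int k * b)) \<partial>period_measure b)"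
  proof (rule integral_periodize[OF b_pos])
    show "integrable lborel h"
    proof (rule Bochner_Integration.integrable_bound)
      \<comment> \<open>\<open>h\<close> vanishes off a window of length \<open>c\<close>, and there
        \<open>cmod (f t) \<le> 1 + (cmod (f t))^2\<close> turns square integrability into
        integrability.\<close>
      show "integrable lborel (\<lambda>t. indicator {of_int m * a..<of_int m * a + c} t + (cmod (f t))\<^sup>2)"
        using f c_pos by (intro Bochner_Integration.integrable_add) (auto simp: L2_def)
      show "AE t in lborel. norm (h t) \<le> norm (indicator {of_int m * a..<of_int m * a + c} t + (cmod (f t))\<^sup>2)"
      proof (rule AE_I2)
        fix t
        have "cmod (f t) \<le> 1 + (cmod (f t))\<^sup>2"
          using sum_squares_bound[of "cmod (f t)" 1] by (smt (verit) mult_cancel_left1 norm_ge_zero one_power2 power2_eq_square)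
        then show "norm (h t) \<le> norm (indicator {of_int m * a..<of_int m * a + c} t + (cmod (f t))\<^sup>2)"
          by (auto simp: h_def norm_mult indicator_def)
      qed
    qed simp
    show "\<lfloor>t / b\<rfloor> \<in> col_range m" if "h t \<noteq> 0" for t
    proof -
      have "t - of_int m * a \<in> {0..<c}" using that by (auto simp: h_def indicator_def split: if_splits)
      moreover have "t - of_int \<lfloor>t / b\<rfloor> * b \<in> {0..<b}" using mem_period_iff[OF b_pos] by blast
      ultimately show ?thesis by (auto simp: col_range_def)
    qed
  qed simp
  also have "\<dots> = (\<integral>t. row_fun f m t * fexp b n t \<partial>period_measure b)"
  proof (rule Bochner_Integration.integral_cong[OF refl])
    fix t
    have "h (t + of_int k * b) = f (t + of_int k * b) * chi (t - of_int m * a + of_int k * b) * fexp b n t" for k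
      unfolding h_def fexp_periodic[OF b_pos] by (simp add: algebra_simps)
    then show "(\<Sum>k\<in>col_range m. h (t + of_int k * b)) = row_fun f m t * fexp b n t"
      by (simp only: row_fun_def sum_distrib_right)
  qed
  finally show ?thesis .
qed

lemma gabor_sum_eq:
  "gabor_sum f = ennreal b * (\<integral>\<^sup>+t. (\<integral>\<^sup>+m. ennreal ((cmod (row_fun f m t))\<^sup>2) \<partial>count_space UNIV)
      \<partial>period_measure b)"
proof -
  have "gabor_sum f = (\<integral>\<^sup>+m. (\<integral>\<^sup>+n. ennreal ((cmod (L2_inner f (gabor_atom chi a b (m, n))))\<^sup>2)
      \<partial>count_space UNIV) \<partial>count_space UNIV)"
    unfolding gabor_sum_def by (rule nn_integral_fst_count_space[symmetric])
  also have "\<dots> = (\<integral>\<^sup>+m. ennreal b * (\<integral>\<^sup>+t. ennreal ((cmod (row_fun f m t))\<^sup>2) \<partial>period_measure b)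
      \<partial>count_space UNIV)"
    unfolding L2_inner_gabor_atom parseval[OF b_pos measurable_row_fun row_fun_square_integrable] ..
  also have "\<dots> = ennreal b * (\<integral>\<^sup>+m. (\<integral>\<^sup>+t. ennreal ((cmod (row_fun f m t))\<^sup>2) \<partial>period_measure b)
      \<partial>count_space UNIV)"
    by (rule nn_integral_cmult) simp
  also have "\<dots> = ennreal b * (\<integral>\<^sup>+t. (\<integral>\<^sup>+m. ennreal ((cmod (row_fun f m t))\<^sup>2) \<partial>count_space UNIV)
      \<partial>period_measure b)"
    by (subst nn_integral_count_space_nn_integral) (auto simp: measurable_period_measure)
  finally show ?thesis .
qed

lemma nn_integral_measurable_row_fun:
  "(\<lambda>t. \<integral>\<^sup>+m. ennreal ((cmod (row_fun f m t))\<^sup>2) \<partial>count_space UNIV) \<in> borel_measurable (period_measure b)"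
  unfolding nn_integral_count_space_int measurable_period_measure by measurable

end

declare L2_measurable [measurable del]

end

section \<open>Frame bounds\<close>

text \<open>After exchanging the two sums, \<open>f j\<close> is counted once for each
  \<open>i\<close> with \<open>j \<in> A i\<close>.\<close>

lemma nn_integral_double_count:
  fixes A :: "int \<Rightarrow> int set" and f :: "int \<Rightarrow> ennreal"
  assumes A: "\<And>i. finite (A i)" and fin: "\<And>j. finite {i. j \<in> A i}" and N: "\<And>j. card {i. j \<in> A i} \<le> N"
  shows "(\<integral>\<^sup>+i. (\<Sum>j\<in>A i. f j) \<partial>count_space UNIV) \<le> of_nat N * (\<integral>\<^sup>+j. f j \<partial>count_space UNIV)"
proof -
  have "(\<integral>\<^sup>+i. (\<Sum>j\<in>A i. f j) \<partial>count_space UNIV)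
      = (\<integral>\<^sup>+i. (\<integral>\<^sup>+j. indicator (A i) j * f j \<partial>count_space UNIV) \<partial>count_space UNIV)"
    using A by (intro nn_integral_cong, subst nn_integral_count_space'[of "A _"]) (auto simp: indicator_def)
  also have "\<dots> = (\<integral>\<^sup>+j. (\<integral>\<^sup>+i. indicator (A i) j * f j \<partial>count_space UNIV) \<partial>count_space UNIV)"
    by (rule nn_integral_count_space_nn_integral[symmetric]) auto
  also have "\<dots> \<le> (\<integral>\<^sup>+j. of_nat N * f j \<partial>count_space UNIV)"
  proof (rule nn_integral_mono)
    fix j
    have "(\<integral>\<^sup>+i. indicator (A i) j * f j \<partial>count_space UNIV) = of_nat (card {i. j \<in> A i}) * f j"
      using fin[of j] by (subst nn_integral_count_space'[of "{i. j \<in> A i}"]) (auto simp: indicator_def)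
    also have "\<dots> \<le> of_nat N * f j" using N[of j] by (intro mult_right_mono) auto
    finally show "(\<integral>\<^sup>+i. indicator (A i) j * f j \<partial>count_space UNIV) \<le> of_nat N * f j" .
  qed
  also have "\<dots> = of_nat N * (\<integral>\<^sup>+j. f j \<partial>count_space UNIV)" by (rule nn_integral_cmult) simp
  finally show ?thesis .
qed

lemma ennreal_cmod_sum_sq_le:
  assumes "card I \<le> N"
  shows "ennreal ((cmod (\<Sum>i\<in>I. x i))\<^sup>2) \<le> of_nat N * (\<Sum>i\<in>I. ennreal ((cmod (x i))\<^sup>2))"
proof -
  have "(cmod (\<Sum>i\<in>I. x i))\<^sup>2 \<le> real (card I) * (\<Sum>i\<in>I. (cmod (x i))\<^sup>2)" by (rule cmod_sum_sq_le)
  also have "\<dots> \<le> real N * (\<Sum>i\<in>I. (cmod (x i))\<^sup>2)"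
    using assms by (intro mult_right_mono sum_nonneg) auto
  finally have "ennreal ((cmod (\<Sum>i\<in>I. x i))\<^sup>2) \<le> ennreal (real N * (\<Sum>i\<in>I. (cmod (x i))\<^sup>2))"
    by (rule ennreal_leI)
  also have "\<dots> = of_nat N * (\<Sum>i\<in>I. ennreal ((cmod (x i))\<^sup>2))"
    by (simp add: ennreal_mult sum_nonneg sum_ennreal ennreal_of_nat_eq_real_of_nat)
  finally show ?thesis .
qed

lemma card_int_interval_le:
  fixes u v d :: real
  assumes "0 < d" "0 \<le> v" and S: "S \<subseteq> {j::int. u \<le> of_int j * d \<and> of_int j * d \<le> u + v}"
  shows "finite S" "card S \<le> nat \<lceil>v / d + 1\<rceil>"
proof -
  note fin = bounded_int_interval_card[OF assms(1,2), of u]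
  show "finite S" using S fin(1) by (rule finite_subset)
  have "card S \<le> card {j::int. u \<le> of_int j * d \<and> of_int j * d \<le> u + v}"
    using S fin(1) by (intro card_mono)
  also have "\<dots> \<le> nat \<lceil>v / d + 1\<rceil>" using fin(2) by linarith
  finally show "card S \<le> nat \<lceil>v / d + 1\<rceil>" .
qed

context abc
begin

definition max_row :: nat where "max_row = nat \<lceil>c / b + 1\<rceil>"

definition max_col :: nat where "max_col = nat \<lceil>c / a + 1\<rceil>"

lemma card_row_le: "card (row t m) \<le> max_row"
  unfolding max_row_def using b_pos c_pos
  by (intro card_int_interval_le(2)[where u="of_int m * a - t"]) (auto simp: mem_row_iff)

lemma finite_col [simp]: "finite {m. k \<in> row t m}" and card_col_le: "card {m. k \<in> row t m} \<le> max_col"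
proof -
  have S: "{m. k \<in> row t m} \<subseteq> {j. t + of_int k * b - c \<le> of_int j * a \<and> of_int j * a \<le> t + of_int k * b - c + c}"
    by (auto simp: mem_row_iff)
  have c: "0 \<le> c" using c_pos by simp
  show "finite {m. k \<in> row t m}" "card {m. k \<in> row t m} \<le> max_col"
    unfolding max_col_def using card_int_interval_le[OF a_pos c S] by auto
qed

definition row_energy :: "real \<Rightarrow> (int \<Rightarrow> complex) \<Rightarrow> ennreal" where
  "row_energy t x = (\<integral>\<^sup>+m. ennreal ((cmod (\<Sum>k\<in>row t m. x k))\<^sup>2) \<partial>count_space UNIV)"

definition energy :: "(int \<Rightarrow> complex) \<Rightarrow> ennreal" where
  "energy x = (\<integral>\<^sup>+k. ennreal ((cmod (x k))\<^sup>2) \<partial>count_space UNIV)"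

lemma row_energy_le: "row_energy t x \<le> of_nat (max_row * max_col) * energy x"
proof -
  have "row_energy t x \<le> (\<integral>\<^sup>+m. of_nat max_row * (\<Sum>k\<in>row t m. ennreal ((cmod (x k))\<^sup>2)) \<partial>count_space UNIV)"
    unfolding row_energy_def by (intro nn_integral_mono ennreal_cmod_sum_sq_le card_row_le)
  also have "\<dots> = of_nat max_row * (\<integral>\<^sup>+m. (\<Sum>k\<in>row t m. ennreal ((cmod (x k))\<^sup>2)) \<partial>count_space UNIV)"
    by (rule nn_integral_cmult) simp
  also have "\<dots> \<le> of_nat max_row * (of_nat max_col * energy x)"
    unfolding energy_def by (intro mult_left_mono nn_integral_double_count card_col_le) auto
  finally show ?thesis by (simp add: mult.assoc)
qed

text \<open>The constant is \<open>4 * P * Q\<close>: \<open>P\<close> bounds the rows used for one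
  entry and enters through Cauchy-Schwarz, \<open>Q\<close> bounds the entries for which one row is
  used, and 4 is the square of the factor 2 lost in passing to real and imaginary parts.
  \<open>P\<close> and \<open>Q\<close> do not depend on \<open>t\<close> because \<open>D\<close>
  does not.\<close>

lemma energy_le_row_energy:
  assumes trivial_kernel
  obtains C :: nat where "\<And>t x. energy x \<le> of_nat C * row_energy t x"
proof -
  obtain D where D: "0 \<le> D" and sep: "\<And>t z. (\<And>k. z k \<in> {-1, 0, 1 :: real}) \<Longrightarrow> z 0 = 1 \<Longrightarrow>
      \<exists>j. \<bar>of_int j * a - t\<bar> \<le> D \<and> sum z (row t j) \<noteq> 0"
    using uniform_separation[OF assms] by metis
  define J where "J t k = {j. \<bar>of_int j * a - (t + of_int k * b)\<bar> \<le> D}" for t and k :: int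
  define P where "P = nat \<lceil>2 * D / a + 1\<rceil>"
  define Q where "Q = nat \<lceil>2 * D / b + 1\<rceil>"
  have J: "finite (J t k)" "card (J t k) \<le> P" for t k
  proof -
    have "J t k \<subseteq> {j. t + of_int k * b - D \<le> of_int j * a \<and> of_int j * a \<le> t + of_int k * b - D + 2 * D}"
      by (auto simp: J_def)
    moreover have "0 \<le> 2 * D" using D by simp
    ultimately show "finite (J t k)" "card (J t k) \<le> P"
      unfolding P_def using card_int_interval_le[OF a_pos] by blast+
  qed
  have J': "finite {k. j \<in> J t k}" "card {k. j \<in> J t k} \<le> Q" for t j
  proof -
    have "{k. j \<in> J t k} \<subseteq> {k. of_int j * a - t - D \<le> of_int k * b \<and> of_int k * b \<le> of_int j * a - t - D + 2 * D}"
      by (auto simp: J_def)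
    moreover have "0 \<le> 2 * D" using D by simp
    ultimately show "finite {k. j \<in> J t k}" "card {k. j \<in> J t k} \<le> Q"
      unfolding Q_def using card_int_interval_le[OF b_pos] by blast+
  qed
  have le_real: "x k \<le> (\<Sum>j\<in>J t k. \<bar>sum x (row t j)\<bar>)" for x :: "int \<Rightarrow> real" and t k
  proof -
    \<comment> \<open>\<open>threshold_bound\<close> speaks of index 0 only; the shift by
      \<open>k\<close> brings entry \<open>k\<close> there and turns \<open>t\<close> into
      \<open>t + k b\<close>.\<close>
    have "(\<lambda>i. x (i + k)) 0 \<le> (\<Sum>j\<in>J t k. \<bar>sum (\<lambda>i. x (i + k)) (row (t + of_int k * b) j)\<bar>)"
      unfolding row_def
    proof (rule threshold_bound)
      show "\<exists>j\<in>J t k. sum z {row_start a b (t + of_int k * b) j..<row_start a b (t + of_int k * b - c) j} \<noteq> 0"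
        if "\<And>i. z i \<in> {-1, 0, 1}" "z 0 = 1" for z :: "int \<Rightarrow> real"
        using sep[where z=z and t="t + of_int k * b"] that by (auto simp: J_def row_def)
    qed (use J row_start_le in auto)
    then show ?thesis by (simp add: sum_row_add_b)
  qed
  have le_abs: "\<bar>x k\<bar> \<le> (\<Sum>j\<in>J t k. \<bar>sum x (row t j)\<bar>)" for x :: "int \<Rightarrow> real" and t k
    using le_real[of x k t] le_real[of "\<lambda>i. - x i" k t] by (simp add: sum_negf)
  have point: "ennreal ((cmod (x k))\<^sup>2) \<le> of_nat (4 * P) * (\<Sum>j\<in>J t k. ennreal ((cmod (sum x (row t j)))\<^sup>2))" for x t k
  proof -
    have "cmod (x k) \<le> \<bar>Re (x k)\<bar> + \<bar>Im (x k)\<bar>" by (rule cmod_le)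
    also have "\<dots> \<le> (\<Sum>j\<in>J t k. \<bar>\<Sum>i\<in>row t j. Re (x i)\<bar>) + (\<Sum>j\<in>J t k. \<bar>\<Sum>i\<in>row t j. Im (x i)\<bar>)"
      by (intro add_mono le_abs)
    also have "\<dots> \<le> (\<Sum>j\<in>J t k. cmod (sum x (row t j))) + (\<Sum>j\<in>J t k. cmod (sum x (row t j)))"
      unfolding Re_sum[symmetric] Im_sum[symmetric]
      by (intro add_mono sum_mono abs_Re_le_cmod abs_Im_le_cmod)
    finally have "(cmod (x k))\<^sup>2 \<le> (2 * (\<Sum>j\<in>J t k. cmod (sum x (row t j))))\<^sup>2"
      by (intro power_mono) auto
    also have "\<dots> = 4 * (cmod (\<Sum>j\<in>J t k. of_real (cmod (sum x (row t j)))))\<^sup>2"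
      by (simp add: power_mult_distrib of_real_sum[symmetric] del: of_real_sum)
    finally have "ennreal ((cmod (x k))\<^sup>2) \<le> 4 * ennreal ((cmod (\<Sum>j\<in>J t k. of_real (cmod (sum x (row t j)))))\<^sup>2)"
      by (simp add: ennreal_leI ennreal_mult'[symmetric] flip: ennreal_numeral)
    also have "\<dots> \<le> 4 * (of_nat P * (\<Sum>j\<in>J t k. ennreal ((cmod (of_real (cmod (sum x (row t j)))))\<^sup>2)))"
      by (intro mult_left_mono ennreal_cmod_sum_sq_le J) simp
    finally show ?thesis by (simp add: mult.assoc)
  qed
  have "energy x \<le> of_nat (4 * P * Q) * row_energy t x" for t x
  proof -
    have "energy x \<le> (\<integral>\<^sup>+k. of_nat (4 * P) * (\<Sum>j\<in>J t k. ennreal ((cmod (sum x (row t j)))\<^sup>2)) \<partial>count_space UNIV)"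
      unfolding energy_def by (intro nn_integral_mono point)
    also have "\<dots> = of_nat (4 * P) * (\<integral>\<^sup>+k. (\<Sum>j\<in>J t k. ennreal ((cmod (sum x (row t j)))\<^sup>2)) \<partial>count_space UNIV)"
      by (rule nn_integral_cmult) simp
    also have "\<dots> \<le> of_nat (4 * P) * (of_nat Q * row_energy t x)"
      unfolding row_energy_def by (intro mult_left_mono nn_integral_double_count J J') auto
    finally show ?thesis by (simp add: mult.assoc)
  qed
  then show thesis by (rule that)
qed

lemma gabor_sum_eq_row_energy:
  assumes "f \<in> L2"
  shows "gabor_sum f = ennreal b * (\<integral>\<^sup>+t. row_energy t (\<lambda>k. f (t + of_int k * b)) \<partial>period_measure b)"
  unfolding gabor_sum_eq[OF assms]
  by (intro arg_cong2[of _ _ _ _ "(*)"] refl nn_integral_cong_AE)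
     (use AE_period_measure[of b] in \<open>eventually_elim, simp add: row_energy_def row_fun_eq\<close>)

lemma L2_normsq_eq_energy:
  "f \<in> L2 \<Longrightarrow> ennreal (L2_normsq f) = (\<integral>\<^sup>+t. energy (\<lambda>k. f (t + of_int k * b)) \<partial>period_measure b)"
  unfolding energy_def by (rule L2_normsq_eq)

lemma gabor_frame_if_trivial_kernel:
  assumes trivial_kernel
  shows "is_gabor_frame chi a b"
proof -
  obtain C0 :: nat where C0: "\<And>t x. energy x \<le> of_nat C0 * row_energy t x"
    using energy_le_row_energy[OF assms] by metis
  \<comment> \<open>The added 1 makes \<open>C\<close>, and with it \<open>A\<close>, positive;
    adding \<open>A\<close> to the upper constant ensures \<open>A \<le> B\<close>.\<close>
  define C where "C = C0 + 1"
  define A where "A = b / real C"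
  define B where "B = b * real (max_row * max_col) + A"
  have "C > 0" by (simp add: C_def)
  then have "0 < A" using b_pos by (simp add: A_def)
  have "A \<le> B" using b_pos by (simp add: B_def)
  have C: "energy x \<le> of_nat C * row_energy t x" for t x
    using C0[of x t] by (rule order_trans) (auto simp: C_def intro: mult_right_mono)
  have lower: "ennreal (A * L2_normsq f) \<le> gabor_sum f" if f: "f \<in> L2" for f
  proof -
    \<comment> \<open>\<open>row_energy\<close> is replaced by the sum over \<open>row_fun\<close>,
      whose measurability in \<open>t\<close> is known and lets the constant be pulled out of the
      integral.\<close>
    let ?Y = "\<lambda>t. \<integral>\<^sup>+m. ennreal ((cmod (row_fun f m t))\<^sup>2) \<partial>count_space UNIV"
    have "L2_normsq f \<ge> 0" by (simp add: L2_normsq_def)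
    have "ennreal (L2_normsq f) \<le> (\<integral>\<^sup>+t. of_nat C * ?Y t \<partial>period_measure b)"
      unfolding L2_normsq_eq_energy[OF f]
    proof (rule nn_integral_mono_AE)
      show "AE t in period_measure b. energy (\<lambda>k. f (t + of_int k * b)) \<le> of_nat C * ?Y t"
        using AE_period_measure[of b]
      proof eventually_elim
        case (elim t)
        show ?case using C[of "\<lambda>k. f (t + of_int k * b)" t] elim by (simp add: row_energy_def row_fun_eq)
      qed
    qed
    also have "\<dots> = of_nat C * (\<integral>\<^sup>+t. ?Y t \<partial>period_measure b)"
      by (rule nn_integral_cmult[OF nn_integral_measurable_row_fun[OF f]])
    finally have "ennreal A * ennreal (L2_normsq f) \<le> ennreal A * (of_nat C * (\<integral>\<^sup>+t. ?Y t \<partial>period_measure b))"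
      by (rule mult_left_mono) simp
    also have "\<dots> = (ennreal A * ennreal (real C)) * (\<integral>\<^sup>+t. ?Y t \<partial>period_measure b)"
      by (simp add: mult.assoc ennreal_of_nat_eq_real_of_nat)
    also have "ennreal A * ennreal (real C) = ennreal b"
      using \<open>C > 0\<close> \<open>0 < A\<close> by (subst ennreal_mult[symmetric]) (auto simp: A_def)
    also have "ennreal b * (\<integral>\<^sup>+t. ?Y t \<partial>period_measure b) = gabor_sum f"
      by (rule gabor_sum_eq[OF f, symmetric])
    finally show ?thesis using \<open>0 < A\<close> \<open>L2_normsq f \<ge> 0\<close> by (simp add: ennreal_mult)
  qed
  have upper: "gabor_sum f \<le> ennreal (B * L2_normsq f)" if f: "f \<in> L2" for f
  proof -
    have "L2_normsq f \<ge> 0" by (simp add: L2_normsq_def)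
    have "gabor_sum f \<le> ennreal b * (\<integral>\<^sup>+t. of_nat (max_row * max_col) * energy (\<lambda>k. f (t + of_int k * b)) \<partial>period_measure b)"
      unfolding gabor_sum_eq_row_energy[OF f] by (intro mult_left_mono nn_integral_mono row_energy_le) auto
    also have "\<dots> = ennreal b * (of_nat (max_row * max_col) * ennreal (L2_normsq f))"
      unfolding L2_normsq_eq_energy[OF f] energy_def
      by (subst nn_integral_cmult[OF nn_integral_translates_measurable[OF f]]) (rule refl)
    also have "\<dots> = ennreal (b * real (max_row * max_col) * L2_normsq f)"
      using b_pos \<open>L2_normsq f \<ge> 0\<close>
      by (simp only: ennreal_of_nat_eq_real_of_nat ennreal_mult[symmetric] mult.assoc
          of_nat_0_le_iff mult_nonneg_nonneg less_imp_le)
    also have "\<dots> \<le> ennreal (B * L2_normsq f)"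
      using \<open>0 < A\<close> \<open>L2_normsq f \<ge> 0\<close> by (intro ennreal_leI mult_right_mono) (auto simp: B_def)
    finally show ?thesis .
  qed
  show ?thesis
    unfolding is_gabor_frame_def using \<open>0 < A\<close> \<open>A \<le> B\<close> lower upper
    unfolding gabor_sum_def by blast
qed

end

section \<open>Kernel vectors contradict the lower frame bound\<close>

context abc
begin

text \<open>Rows are continuous from the right one at a time, not uniformly in \<open>m\<close>.
  Finite support leaves finitely many rows to watch for \<open>s\<close> in
  \<open>[t, t + 1)\<close>; all others have sum zero at both parameters.\<close>

lemma eventually_row_sums_eq:
  fixes x :: "int \<Rightarrow> complex"
  assumes supp: "\<And>k. x k \<noteq> 0 \<Longrightarrow> \<bar>k\<bar> \<le> N"
  shows "\<forall>\<^sub>F s in at_right t. \<forall>m. sum x (row s m) = sum x (row t m)"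
proof -
  \<comment> \<open>\<open>N\<close> is any integer here, so its absolute value is used to keep the
    length of the interval nonnegative.\<close>
  let ?M = "{m. t - of_int N * b - c \<le> of_int m * a \<and>
    of_int m * a \<le> t - of_int N * b - c + (2 * \<bar>of_int N\<bar> * b + c + 1)}"
  have "finite ?M" using a_pos b_pos c_pos by (intro bounded_int_interval_card) auto
  then have "\<forall>\<^sub>F s in at_right t. \<forall>m\<in>?M. row s m = row t m"
    by (intro eventually_ball_finite ballI eventually_row_eq tendsto_ident_at)
       (auto simp: eventually_at_right_field intro!: exI[of _ "t + 1"])
  moreover have "\<forall>\<^sub>F s in at_right t. t < s \<and> s < t + 1"
    by (auto simp: eventually_at_right_field intro!: exI[of _ "t + 1"])
  ultimately show ?thesis
  proof eventually_elim
    case (elim s)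
    have zero: "sum x (row u m) = 0" if "m \<notin> ?M" "t \<le> u" "u < t + 1" for m u
    proof (rule sum.neutral, intro ballI, rule ccontr)
      fix k assume k: "k \<in> row u m" "x k \<noteq> 0"
      then have "\<bar>k\<bar> \<le> N" using supp by blast
      then have "- of_int N \<le> real_of_int k" "real_of_int k \<le> of_int N" by linarith+
      then have "- of_int N * b \<le> real_of_int k * b" "real_of_int k * b \<le> of_int N * b"
        using b_pos by (simp_all only: mult_right_mono less_imp_le)
      moreover have "real_of_int \<bar>N\<bar> = of_int N" using \<open>\<bar>k\<bar> \<le> N\<close> by linarith
      ultimately have "m \<in> ?M" using k(1) that(2,3) by (auto simp: mem_row_iff algebra_simps)
      with that(1) show False ..
    qed
    show ?case
    proof
      fix m
      show "sum x (row s m) = sum x (row t m)"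
        using elim zero[of m s] zero[of m t] by (cases "m \<in> ?M") auto
    qed
  qed
qed

text \<open>The test function takes the value \<open>x k\<close> on a short interval
  \<open>[t, v) + k b\<close>. The row sums do not change along \<open>[t, v)\<close>, so both sides
  of the frame inequality are \<open>\<eta>\<close> times their discrete counterparts, and
  \<open>\<eta> > 0\<close> cancels.\<close>

lemma frame_lower_bound_finite_support:
  fixes x :: "int \<Rightarrow> complex"
  assumes frame: "\<And>f. f \<in> L2 \<Longrightarrow> ennreal (A * L2_normsq f) \<le> gabor_sum f" and "0 < A"
    and t: "t \<in> {0..<b}" and supp: "\<And>k. x k \<noteq> 0 \<Longrightarrow> \<bar>k\<bar> \<le> N"
  shows "ennreal A * energy x \<le> ennreal b * row_energy t x"
proof -
  have "\<forall>\<^sub>F s in at_right t. \<forall>m. sum x (row s m) = sum x (row t m)"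
    by (rule eventually_row_sums_eq[OF supp])
  then obtain u where u: "t < u" "\<And>s m. t < s \<Longrightarrow> s < u \<Longrightarrow> sum x (row s m) = sum x (row t m)"
    unfolding eventually_at_right_field by blast
  \<comment> \<open>The cap at \<open>b\<close> keeps \<open>[t, v)\<close> within one period, so
    that its translates by multiples of \<open>b\<close> do not overlap.\<close>
  define v where "v = min u b"
  define \<eta> where "\<eta> = v - t"
  have "\<eta> > 0" "v \<le> b" using u(1) t by (auto simp: \<eta>_def v_def)
  have same: "sum x (row s m) = sum x (row t m)" if "s \<in> {t..<v}" for s m
    using u(2)[of s m] that by (cases "s = t") (auto simp: v_def)
  define f where "f s = indicator {t..<v} (s - of_int \<lfloor>s / b\<rfloor> * b) * x \<lfloor>s / b\<rfloor>" for s
  have [measurable]: "(\<lambda>s. x \<lfloor>s / b\<rfloor>) \<in> borel_measurable borel"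
    by (rule measurable_compose[of _ _ "count_space UNIV"]) auto
  have [measurable]: "f \<in> borel_measurable borel"
    unfolding f_def by measurable
  have f_translate: "f (s + of_int k * b) = indicator {t..<v} s * x k" if "s \<in> {0..<b}" for s k
  proof -
    have "k = \<lfloor>(s + of_int k * b) / b\<rfloor>"
      using mem_period_iff[OF b_pos, of "s + of_int k * b" k] that by simp
    then show ?thesis by (simp add: f_def)
  qed
  have ind: "(\<integral>\<^sup>+s. indicator {t..<v} s * K \<partial>period_measure b) = ennreal \<eta> * K" for K
  proof -
    have "(\<integral>\<^sup>+s. indicator {t..<v} s * K \<partial>period_measure b) = (\<integral>\<^sup>+s. indicator {0..<b} s * (indicator {t..<v} s * K) \<partial>lborel)"
      by (rule nn_integral_period_measure) auto
    also have "\<dots> = (\<integral>\<^sup>+s. K * indicator {t..<v} s \<partial>lborel)"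
      using t \<open>v \<le> b\<close> by (intro nn_integral_cong) (auto simp: indicator_def)
    also have "\<dots> = ennreal \<eta> * K" using \<open>\<eta> > 0\<close> by (simp add: nn_integral_cmult_indicator \<eta>_def mult.commute)
    finally show ?thesis .
  qed
  have en: "energy (\<lambda>k. f (s + of_int k * b)) = indicator {t..<v} s * energy x" if "s \<in> {0..<b}" for s
    unfolding energy_def f_translate[OF that] by (auto simp: indicator_def)
  have "(\<integral>\<^sup>+s. energy (\<lambda>k. f (s + of_int k * b)) \<partial>period_measure b) = (\<integral>\<^sup>+s. indicator {t..<v} s * energy x \<partial>period_measure b)"
    using AE_period_measure[of b] by (intro nn_integral_cong_AE, eventually_elim) (rule en)
  then have norm_f: "(\<integral>\<^sup>+s. energy (\<lambda>k. f (s + of_int k * b)) \<partial>period_measure b) = ennreal \<eta> * energy x"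
    by (simp only: ind)
  have "energy x = (\<Sum>k\<in>{-N..N}. ennreal ((cmod (x k))\<^sup>2))"
    unfolding energy_def
  proof (rule nn_integral_count_space')
    show "ennreal ((cmod (x k))\<^sup>2) = 0" if "k \<notin> {-N..N}" for k
      using that supp[of k] by (cases "x k = 0") auto
  qed auto
  then have "energy x < \<infinity>" by (simp add: sum_ennreal)
  have "f \<in> L2"
    unfolding L2_def
  proof (intro CollectI conjI integrableI_bounded)
    have "(\<integral>\<^sup>+s. ennreal (norm ((cmod (f s))\<^sup>2)) \<partial>lborel) = ennreal \<eta> * energy x"
      using nn_integral_periodize[OF b_pos, of "\<lambda>s. ennreal (norm ((cmod (f s))\<^sup>2))"] norm_f
      by (simp add: energy_def)
    also have "\<dots> < \<infinity>" using \<open>energy x < \<infinity>\<close> by (simp add: ennreal_mult_less_top)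
    finally show "(\<integral>\<^sup>+s. ennreal (norm ((cmod (f s))\<^sup>2)) \<partial>lborel) < \<infinity>" .
  qed auto
  have ren: "row_energy s (\<lambda>k. f (s + of_int k * b)) = indicator {t..<v} s * row_energy t x" if "s \<in> {0..<b}" for s
    unfolding row_energy_def f_translate[OF that] using same[of s] by (auto simp: indicator_def)
  have "(\<integral>\<^sup>+s. row_energy s (\<lambda>k. f (s + of_int k * b)) \<partial>period_measure b)
      = (\<integral>\<^sup>+s. indicator {t..<v} s * row_energy t x \<partial>period_measure b)"
    using AE_period_measure[of b] by (intro nn_integral_cong_AE, eventually_elim) (rule ren)
  then have "gabor_sum f = ennreal \<eta> * (ennreal b * row_energy t x)"
    unfolding gabor_sum_eq_row_energy[OF \<open>f \<in> L2\<close>] by (simp add: ind mult.left_commute)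
  moreover have "ennreal (A * L2_normsq f) = ennreal \<eta> * (ennreal A * energy x)"
  proof -
    have "ennreal (A * L2_normsq f) = ennreal A * ennreal (L2_normsq f)"
      using \<open>0 < A\<close> by (intro ennreal_mult) (auto simp: L2_normsq_def)
    then show ?thesis unfolding L2_normsq_eq_energy[OF \<open>f \<in> L2\<close>] norm_f by (simp add: mult.left_commute)
  qed
  ultimately have "ennreal \<eta> * (ennreal A * energy x) \<le> ennreal \<eta> * (ennreal b * row_energy t x)"
    using frame[OF \<open>f \<in> L2\<close>] by simp
  then show ?thesis using \<open>\<eta> > 0\<close> by (simp add: ennreal_mult_le_mult_iff)
qed

text \<open>A kernel vector need not be square summable, so the frame bound is applied to its
  truncations \<open>x N\<close>. Their energy is the number of nonzero entries up to
  \<open>N\<close>, while their row energy is bounded independently of \<open>N\<close>; hence only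
  finitely many entries are nonzero. But then some truncation is the kernel vector itself, with row
  energy 0, and the bound leaves no nonzero entry at all.\<close>

lemma trivial_kernel_if_gabor_frame:
  assumes "is_gabor_frame chi a b"
  shows trivial_kernel
proof (rule ccontr)
  assume "\<not> trivial_kernel"
  then obtain t0 and z0 :: "int \<Rightarrow> real" and k0
    where z0: "\<And>k. z0 k \<in> {-1, 0, 1}" and ker0: "\<And>j. sum z0 (row t0 j) = 0" and k0: "z0 k0 \<noteq> 0"
    unfolding trivial_kernel_def by blast
  define i where "i = \<lfloor>t0 / b\<rfloor>"
  define t where "t = t0 - of_int i * b"
  define z where "z k = z0 (k - i)" for k
  have t: "t \<in> {0..<b}" using mem_period_iff[OF b_pos] by (auto simp: t_def i_def simp del: atLeastLessThan_iff)
  have z: "z k \<in> {-1, 0, 1}" for k using z0 by (simp add: z_def)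
  have ker: "sum z (row t j) = 0" for j
    using ker0[of j] sum_row_add_b[of z0 t i j] by (simp add: z_def[abs_def] t_def)
  obtain A where "0 < A" and frame: "\<And>f. f \<in> L2 \<Longrightarrow> ennreal (A * L2_normsq f) \<le> gabor_sum f"
    using assms unfolding is_gabor_frame_def gabor_sum_def by blast
  define x where "x N k = (if \<bar>k\<bar> \<le> int N then complex_of_real (z k) else 0)" for N k
  define S where "S = {k. z k \<noteq> 0}"
  have energy_x: "energy (x N) = of_nat (card (S \<inter> {- int N..int N}))" for N
  proof -
    have "energy (x N) = (\<Sum>k\<in>S \<inter> {- int N..int N}. ennreal ((cmod (x N k))\<^sup>2))"
      unfolding energy_def by (rule nn_integral_count_space') (auto simp: x_def S_def)
    also have "\<dots> = (\<Sum>k\<in>S \<inter> {- int N..int N}. 1)"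
    proof (rule sum.cong[OF refl])
      fix k assume "k \<in> S \<inter> {- int N..int N}"
      then show "ennreal ((cmod (x N k))\<^sup>2) = 1" using z[of k] by (auto simp: x_def S_def)
    qed
    finally show ?thesis by simp
  qed
  have bound: "ennreal A * of_nat (card (S \<inter> {- int N..int N})) \<le> ennreal b * row_energy t (x N)" for N
    unfolding energy_x[symmetric]
    by (rule frame_lower_bound_finite_support[OF frame \<open>0 < A\<close> t, where N="int N"]) (auto simp: x_def split: if_splits)
  have row_x: "ennreal ((cmod (sum (x N) (row t m)))\<^sup>2)
      \<le> of_nat (max_row * max_row) * (indicator {m. int N \<in> row t m} m + indicator {m. - int N \<in> row t m} m)" for N m
  proof (cases "int N \<in> row t m \<or> - int N \<in> row t m")
    case True
    have "ennreal ((cmod (sum (x N) (row t m)))\<^sup>2) \<le> of_nat max_row * (\<Sum>k\<in>row t m. ennreal ((cmod (x N k))\<^sup>2))"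
      by (rule ennreal_cmod_sum_sq_le[OF card_row_le])
    also have "\<dots> \<le> of_nat max_row * (\<Sum>k\<in>row t m. 1)"
    proof (intro mult_left_mono sum_mono)
      show "ennreal ((cmod (x N k))\<^sup>2) \<le> 1" for k using z[of k] by (auto simp: x_def)
    qed simp
    also have "\<dots> \<le> of_nat max_row * of_nat max_row"
      using card_row_le[of t m] by (intro mult_left_mono) auto
    also have "\<dots> = of_nat (max_row * max_row) * 1" by simp
    also have "\<dots> \<le> of_nat (max_row * max_row) * (indicator {m. int N \<in> row t m} m + indicator {m. - int N \<in> row t m} m)"
      using True by (intro mult_left_mono) (auto simp: indicator_def)
    finally show ?thesis .
  next
    case False
    \<comment> \<open>A row is an interval; if it contains neither \<open>N\<close> nor
      \<open>- N\<close>, it lies wholly inside or wholly outside the range of the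
      truncation.\<close>
    then consider "\<forall>k\<in>row t m. \<bar>k\<bar> \<le> int N" | "\<forall>k\<in>row t m. \<not> \<bar>k\<bar> \<le> int N"
      unfolding row_def by fastforce
    then have "sum (x N) (row t m) = 0"
    proof cases
      case 1
      then have "sum (x N) (row t m) = of_real (sum z (row t m))"
        unfolding of_real_sum by (intro sum.cong) (auto simp: x_def)
      then show ?thesis by (simp add: ker)
    next
      case 2
      then show ?thesis by (intro sum.neutral) (auto simp: x_def)
    qed
    then show ?thesis by simp
  qed
  \<comment> \<open>Only rows through \<open>N\<close> or \<open>- N\<close> contribute: at most
    \<open>max_col\<close> for each, with squared sum at most
    \<open>max_row * max_row\<close>.\<close>
  define R where "R = max_row * max_row * (max_col + max_col)"
  have row_energy_x: "row_energy t (x N) \<le> of_nat R" for N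
  proof -
    have count: "(\<integral>\<^sup>+m. indicator {m. k \<in> row t m} m \<partial>count_space UNIV) \<le> of_nat max_col" for k
      using card_col_le[of k t] by (simp add: emeasure_count_space_finite)
    have "row_energy t (x N) \<le> (\<integral>\<^sup>+m. of_nat (max_row * max_row) *
        (indicator {m. int N \<in> row t m} m + indicator {m. - int N \<in> row t m} m) \<partial>count_space UNIV)"
      unfolding row_energy_def by (intro nn_integral_mono row_x)
    also have "\<dots> = of_nat (max_row * max_row) * ((\<integral>\<^sup>+m. indicator {m. int N \<in> row t m} m \<partial>count_space UNIV)
        + (\<integral>\<^sup>+m. indicator {m. - int N \<in> row t m} m \<partial>count_space UNIV))"
      by (subst nn_integral_cmult, simp, subst nn_integral_add) auto
    also have "\<dots> \<le> of_nat (max_row * max_row) * (of_nat max_col + of_nat max_col)"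
      by (intro mult_left_mono add_mono count) simp
    finally show ?thesis by (simp add: R_def)
  qed
  have card_le: "A * real (card (S \<inter> {- int N..int N})) \<le> b * real R" for N
  proof -
    have "ennreal (A * real (card (S \<inter> {- int N..int N}))) = ennreal A * of_nat (card (S \<inter> {- int N..int N}))"
      using \<open>0 < A\<close> by (simp add: ennreal_mult ennreal_of_nat_eq_real_of_nat)
    also have "\<dots> \<le> ennreal b * row_energy t (x N)" by (rule bound)
    also have "\<dots> \<le> ennreal b * of_nat R" by (intro mult_left_mono row_energy_x) simp
    also have "\<dots> = ennreal (b * real R)" using b_pos by (simp add: ennreal_mult ennreal_of_nat_eq_real_of_nat)
    finally show ?thesis using b_pos by simp
  qed
  have cover: "\<exists>N. F \<subseteq> {- int N..int N}" if "finite F" for F :: "int set"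
  proof -
    have "\<bar>k\<bar> \<le> (\<Sum>k\<in>F. \<bar>k\<bar>)" if "k \<in> F" for k
      using that \<open>finite F\<close> by (intro member_le_sum) auto
    then show ?thesis by (intro exI[of _ "nat (\<Sum>k\<in>F. \<bar>k\<bar>)"]) force
  qed
  have "finite S"
  proof (rule ccontr)
    assume "infinite S"
    then obtain F where F: "finite F" "card F = nat \<lceil>b * real R / A\<rceil> + 1" "F \<subseteq> S"
      by (metis infinite_arbitrarily_large)
    obtain N where "F \<subseteq> {- int N..int N}" using cover[OF F(1)] by blast
    then have "card F \<le> card (S \<inter> {- int N..int N})" using F by (intro card_mono) auto
    then have "b * real R / A < real (card (S \<inter> {- int N..int N}))" using F(2) by linarith
    then show False using card_le[of N] \<open>0 < A\<close> by (simp add: pos_divide_less_eq mult.commute)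
  qed
  then obtain N where N: "S \<subseteq> {- int N..int N}" using cover by blast
  have "z k = 0" if "\<not> \<bar>k\<bar> \<le> int N" for k
  proof -
    have "k \<notin> S"
    proof
      assume "k \<in> S"
      then have "k \<in> {- int N..int N}" using N by blast
      then show False using that by auto
    qed
    then show ?thesis by (simp add: S_def)
  qed
  then have "x N k = of_real (z k)" for k by (auto simp: x_def)
  then have "sum (x N) (row t m) = of_real (sum z (row t m))" for m by simp
  then have "row_energy t (x N) = 0" by (simp add: row_energy_def ker)
  then have "ennreal A * of_nat (card (S \<inter> {- int N..int N})) = 0" using bound[of N] by simp
  then have "card (S \<inter> {- int N..int N}) = 0" using \<open>0 < A\<close> by auto
  then have "S = {}" using N \<open>finite S\<close> by (simp add: Int_absorb2)
  moreover have "k0 + i \<in> S" using k0 by (simp add: S_def z_def)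
  ultimately show False by simp
qed

lemma trivial_kernel_iff:
  "trivial_kernel \<longleftrightarrow> (\<forall>t::real. \<forall>z::int \<Rightarrow> real.
     (\<forall>k. z k \<in> {-1, 0, 1}) \<and> (\<forall>j. M_apply a b c t z j = 0) \<longrightarrow> (\<forall>k. z k = 0))"
  by (simp only: trivial_kernel_def M_apply_eq_sum)

end

theorem theorem3p2:
  fixes a b c :: real
  assumes "0 < a" "a < b" "b < c"
  shows "(is_gabor_frame (\<lambda>t. indicator {0..<c} t) a b
            \<longleftrightarrow> (\<forall>t::real. \<forall>z::int \<Rightarrow> real.
                   (\<forall>k. z k \<in> {-1, 0, 1}) \<and> (\<forall>j. M_apply a b c t z j = 0) \<longrightarrow> (\<forall>k. z k = 0)))
       \<and> ((\<forall>t::real. \<forall>z::int \<Rightarrow> real.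
                   (\<forall>k. z k \<in> {-1, 0, 1}) \<and> (\<forall>j. M_apply a b c t z j = 0) \<longrightarrow> (\<forall>k. z k = 0))
            \<longleftrightarrow> D_set a b c = {})"
proof -
  interpret abc a b c by unfold_locales (use assms in auto)
  show ?thesis
    unfolding trivial_kernel_iff[symmetric]
    using gabor_frame_if_trivial_kernel trivial_kernel_if_gabor_frame
      D_set_empty_if_trivial_kernel trivial_kernel_if_D_set_empty by blast
qed

end
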